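(* Let $\{X_i\}_{i\ge1}$ be a (possibly time-inhomogeneous) Markov chain on $(\mathcal{X},\mathcal{B})$ with transition kernels $\{P_i\}_{i\ge1}$, where $P_i$ is the kernel of the transition from $X_i$ to $X_{i+1}$, all invariant with the same probability measure $\pi$, and with $X_1\sim\pi$. Suppose each $P_i$ has absolute spectral gap $1-\lambda_i>0$. Then for any $n\ge1$ and any bounded measurable functions $f_i:\mathcal{X}\to[a_i,b_i]$, $i=1,\dots,n$, the sum $\sum_{i=1}^n f_i(X_i)$ is sub-Gaussian with variance proxy $$\frac{(b_1-a_1)^2}{8}+\sum_{i=2}^n\alpha(\lambda_{i-1})\cdot\frac{(b_{i-1}-a_{i-1})^2+(b_i-a_i)^2}{8}+\frac{(b_n-a_n)^2}{8}\ \leq\ \alpha\left(\max_{1\leq i\leq n}\lambda_i\right)\cdot\sum_{i=1}^n\frac{(b_i-a_i)^2}{4}.$$ In particular, if $\lambda<1$ is such that $\lambda_i\le\lambda$ for all $i\ge1$, then for any $t\in\mathbb{R}$, $$\mathbb{E}_\pi\left[e^{t\sum_{i=1}^n (f_i(X_i)-\pi(f_i))}\right]\leq \exp\left(\frac{t^2}{2}\cdot\alpha(\lambda)\cdot\sum_{i=1}^n\frac{(b_i-a_i)^2}{4}\right),$$ and for any $\epsilon>0$, $$\mathbb{P}_\pi\left(\left|\sum_{i=1}^n f_i(X_i)-\sum_{i=1}^n\pi(f_i)\right|>\epsilon\right)\leq 2\exp\left(-\frac{\alpha(\lambda)^{-1}\epsilon^2}{2\sum_{i=1}^n (b_i-a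_i)^2/4}\right).$$
   Context: The state space $(\mathcal{X},\mathcal{B})$ is a standard Borel space. A transition kernel $P$ is invariant with a probability measure $\pi$ if $\pi(B)=\int P(x,B)\,\pi(dx)$ for all $B\in\mathcal{B}$. $\mathcal{L}_2(\pi)$ is the real Hilbert space of $\pi$-square-integrable measurable real functions on $\mathcal{X}$, with norm $\|h\|_\pi=\pi(h^2)^{1/2}$, where $\pi(h):=\int h\,d\pi$. A kernel acts on $\mathcal{L}_2(\pi)$ as the Markov operator $Ph(x)=\int h(y)P(x,dy)$. A kernel $P$ has absolute spectral gap $1-\lambda$ if $\lambda:=\sup\{\|Ph\|_\pi:\|h\|_\pi=1,\ \pi(h)=0\}<1$. $\mathbb{E}_\pi$, $\mathbb{P}_\pi$ denote expectation and probability when $X_1\sim\pi$. $\alpha(\lambda)=\frac{1+\lambda}{1-\lambda}$. A random variable $Z$ is sub-Gaussian with variance proxy $\sigma^2$ if it has finite mean and $\mathbb{E}[e^{t(Z-\mathbb{E}Z)}]\le\exp(\sigma^2t^2/2)$ for all $t\in\mathbb{R}$. *)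

theory Defs
  imports "HOL-Probability.Probability"
begin

definition standard_borel_space :: "'a measure \<Rightarrow> bool" where
  "standard_borel_space S \<longleftrightarrow>
     (\<exists>T. completely_metrizable_space T \<and> second_countable T \<and>
          topspace T = space S \<and> sets S = sigma_sets (topspace T) {U. openin T U})"

definition transition_kernel :: "'a measure \<Rightarrow> ('a \<Rightarrow> 'a measure) \<Rightarrow> bool" where
  "transition_kernel S P \<longleftrightarrow> P \<in> S \<rightarrow>\<^sub>M prob_algebra S"

definition invariant_kernel :: "'a measure \<Rightarrow> ('a \<Rightarrow> 'a measure) \<Rightarrow> bool" where
  "invariant_kernel \<pi> P \<longleftrightarrow>
     (\<forall>B\<in>sets \<pi>. emeasure \<pi> B = (\<integral>\<^sup>+x. emeasure (P x) B \<partial>\<pi>))"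

definition L2_fun :: "'a measure \<Rightarrow> ('a \<Rightarrow> real) set" where
  "L2_fun \<pi> = {h \<in> borel_measurable \<pi>. integrable \<pi> (\<lambda>x. (h x)\<^sup>2)}"

definition L2_norm :: "'a measure \<Rightarrow> ('a \<Rightarrow> real) \<Rightarrow> real" where
  "L2_norm \<pi> h = sqrt (\<integral>x. (h x)\<^sup>2 \<partial>\<pi>)"

definition markov_op :: "('a \<Rightarrow> 'a measure) \<Rightarrow> ('a \<Rightarrow> real) \<Rightarrow> 'a \<Rightarrow> real" where
  "markov_op P h x = (\<integral>y. h y \<partial>P x)"

text \<open>The supremum of the norm of \<open>P h\<close> over mean-zero unit vectors \<open>h\<close>. Inserting \<open>0\<close> only matters
  when there is no such \<open>h\<close> (every \<open>\<pi>\<close>-square-integrable function is a.e. constant): the supremum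
  of the empty subset of \<open>[0,\<infinity>)\<close> is then \<open>0\<close>, while the real-valued \<^const>\<open>Sup\<close> is unspecified.
  For an invariant kernel the set is bounded above by \<open>1\<close>.\<close>

definition spectral_lambda :: "'a measure \<Rightarrow> ('a \<Rightarrow> 'a measure) \<Rightarrow> real" where
  "spectral_lambda \<pi> P =
     Sup (insert 0 {L2_norm \<pi> (markov_op P h) |h.
            h \<in> L2_fun \<pi> \<and> L2_norm \<pi> h = 1 \<and> (\<integral>x. h x \<partial>\<pi>) = 0})"

definition has_absolute_spectral_gap :: "'a measure \<Rightarrow> ('a \<Rightarrow> 'a measure) \<Rightarrow> real \<Rightarrow> bool" where
  "has_absolute_spectral_gap \<pi> P g \<longleftrightarrow> spectral_lambda \<pi> P < 1 \<and> g = 1 - spectral_lambda \<pi> P"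

definition past_sigma :: "'w measure \<Rightarrow> 'a measure \<Rightarrow> (nat \<Rightarrow> 'w \<Rightarrow> 'a) \<Rightarrow> nat \<Rightarrow> 'w measure" where
  "past_sigma M S X i = sigma (space M) (\<Union>j\<in>{1..i}. {X j -` A \<inter> space M |A. A \<in> sets S})"

text \<open>Time starts at \<open>1\<close>; \<open>X 0\<close> and \<open>P 0\<close> play no role. The last clause is the Markov property
  \<open>\<P>(X\<^sub>i\<^sub>+\<^sub>1 \<in> B | X\<^sub>1, \<dots>, X\<^sub>i) = P\<^sub>i(X\<^sub>i, B)\<close> almost surely.\<close>

definition markov_chain ::
  "'w measure \<Rightarrow> 'a measure \<Rightarrow> (nat \<Rightarrow> 'a \<Rightarrow> 'a measure) \<Rightarrow> (nat \<Rightarrow> 'w \<Rightarrow> 'a) \<Rightarrow> bool" where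
  "markov_chain M S P X \<longleftrightarrow>
     prob_space M \<and>
     (\<forall>i\<ge>1. transition_kernel S (P i)) \<and>
     (\<forall>i\<ge>1. X i \<in> M \<rightarrow>\<^sub>M S) \<and>
     (\<forall>i\<ge>1. \<forall>B\<in>sets S. AE \<omega> in M.
        real_cond_exp M (past_sigma M S X i) (indicator (X (Suc i) -` B \<inter> space M)) \<omega>
          = measure (P i (X i \<omega>)) B)"

definition gap_alpha :: "real \<Rightarrow> real" where
  "gap_alpha l = (1 + l) / (1 - l)"

text \<open>The parameter \<open>v\<close> is the variance proxy \<open>\<sigma>\<^sup>2\<close>. Integrability of the exponential is required
  explicitly because the Bochner integral of a non-integrable function is \<open>0\<close>.\<close>

definition sub_gaussian :: "'w measure \<Rightarrow> ('w \<Rightarrow> real) \<Rightarrow> real \<Rightarrow> bool" where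
  "sub_gaussian M Z v \<longleftrightarrow>
     integrable M Z \<and>
     (\<forall>t. integrable M (\<lambda>\<omega>. exp (t * (Z \<omega> - (\<integral>\<omega>'. Z \<omega>' \<partial>M)))) \<and>
          (\<integral>\<omega>. exp (t * (Z \<omega> - (\<integral>\<omega>'. Z \<omega>' \<partial>M))) \<partial>M) \<le> exp (v * t\<^sup>2 / 2))"

text \<open>\<open>2 exp (- u / d)\<close> for \<open>u > 0\<close> and \<open>d \<ge> 0\<close>, with the convention \<open>u / 0 = \<infinity>\<close>. In HOL
  \<open>u / 0 = 0\<close>, which would turn the tail bound for constant functions \<open>f\<^sub>i\<close> into the empty
  claim that a probability is at most \<open>2\<close>.\<close>

definition two_exp_neg_div :: "real \<Rightarrow> real \<Rightarrow> real" where
  "two_exp_neg_div u d = (if d = 0 then 0 else 2 * exp (- (u / d)))"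

end

theory Submission
  imports Defs "HOL-Probability.Hoeffding"
begin

text \<open>
  Put \<open>u\<^sub>i = exp (t f\<^sub>i / 2)\<close> with \<open>f\<^sub>i\<close> centred. The moment generating function of the sum is an inner
  product in \<open>L\<^sub>2(\<pi>)\<close> of \<open>u\<^sub>1\<close> with a product of the operators \<open>u\<^sub>i P\<^sub>i u\<^sub>i\<^sub>+\<^sub>1\<close> applied to \<open>u\<^sub>n\<close>.
  The spectral gap gives \<open>\<bar>\<langle>u, P v\<rangle>\<bar> \<le> sqrt (Q u) sqrt (Q v)\<close>, where \<open>Q\<close> is the quadratic form of
  the Leon-Perron operator \<open>l I + (1 - l) \<pi>\<close>, so each factor is controlled by bounding \<open>Q (u\<^sub>i h)\<close>
  by \<open>\<rho> \<pi>(h\<^sup>2)\<close> with \<open>\<rho> = exp (\<alpha>(l) t\<^sup>2 (b\<^sub>i - a\<^sub>i)\<^sup>2 / 8)\<close>.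
  By Cauchy-Schwarz this bound amounts to \<open>\<pi>((1 - l) y / (\<rho> - l y)) \<le> 1\<close> for \<open>y = exp (t f\<^sub>i)\<close>.
  The integrand is convex in \<open>f\<^sub>i\<close>, so only laws on the two endpoints matter, and for these the claim
  reads \<open>\<alpha> cosh x + m sinh x \<le> \<alpha> cosh u + sinh u\<close> with \<open>u = m x + \<alpha> x\<^sup>2 / 2\<close>.
\<close>

section \<open>Two-point estimates\<close>

text \<open>Both sides agree at 0, and the difference has derivative
  \<open>(x * cosh x - sinh x) / 2\<close>. That function also vanishes at 0 and has derivative
  \<open>x * sinh x\<close>, so it is nonnegative.\<close>

lemma cosh_le_one_plus_half_sinh:
  fixes x :: real
  assumes "0 \<le> x"
  shows "cosh x \<le> 1 + x / 2 * sinh x"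
proof -
  have 1: "0 \<le> x * cosh x - sinh x" if "0 \<le> x" for x :: real
  proof -
    have "(\<lambda>x. x * cosh x - sinh x) 0 \<le> (\<lambda>x. x * cosh x - sinh x) x"
    proof (rule DERIV_nonneg_imp_nondecreasing[OF that])
      fix y :: real assume "0 \<le> y" "y \<le> x"
      then show "\<exists>z. ((\<lambda>x. x * cosh x - sinh x) has_real_derivative z) (at y) \<and> 0 \<le> z"
        by (intro exI[of _ "y * sinh y"]) (auto intro!: derivative_eq_intros)
    qed
    then show ?thesis by simp
  qed
  have "(\<lambda>x. 1 + x / 2 * sinh x - cosh x) 0 \<le> (\<lambda>x. 1 + x / 2 * sinh x - cosh x) x"
  proof (rule DERIV_nonneg_imp_nondecreasing[OF assms])
    fix y :: real assume "0 \<le> y" "y \<le> x"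
    then show "\<exists>z. ((\<lambda>x. 1 + x / 2 * sinh x - cosh x) has_real_derivative z) (at y) \<and> 0 \<le> z"
      using 1[of y]
      by (intro exI[of _ "(y * cosh y - sinh y) / 2"]) (auto intro!: derivative_eq_intros simp: field_simps)
  qed
  then show ?thesis by simp
qed

text \<open>After multiplication by \<open>exp x\<close> the left-hand side is
  \<open>1 + p * (exp (2 * x) - 1)\<close> with \<open>p = (1 + m) / 2\<close>, whose logarithm is
  the one estimated in Hoeffding's lemma. For \<open>m \<le> 1\<close> it is the moment generating
  function of a variable with values -1 and 1 and mean \<open>m\<close>. Larger \<open>m\<close>
  must be allowed, because the shifted mean in \<open>two_point_tilt\<close> can exceed 1.\<close>

lemma cosh_plus_sinh_le_exp:
  fixes x m :: real
  assumes "0 \<le> x" "-1 \<le> m"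
  shows "cosh x + m * sinh x \<le> exp (m * x + x\<^sup>2 / 2)"
proof -
  let ?y = "1 + (1 + m) / 2 * (exp (2 * x) - 1)"
  have y: "0 < ?y"
    using assms by (intro add_pos_nonneg mult_nonneg_nonneg) auto
  have "ln ?y \<le> (2 * x) * ((1 + m) / 2) + (2 * x)\<^sup>2 / 8"
    using Hoeffdings_lemma_aux[of "2 * x" "(1 + m) / 2"] assms by simp
  then have "ln ?y \<le> x + (m * x + x\<^sup>2 / 2)"
    by (simp add: field_simps power2_eq_square)
  then have "?y \<le> exp x * exp (m * x + x\<^sup>2 / 2)"
    using y by (metis exp_add exp_le_cancel_iff exp_ln)
  moreover have "?y = exp x * (cosh x + m * sinh x)"
  proof -
    have "exp (2 * x) = exp x * exp x" by (simp flip: exp_add)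
    then show ?thesis by (simp add: cosh_field_def sinh_field_def exp_minus field_simps)
  qed
  ultimately show ?thesis by simp
qed

text \<open>With \<open>m' = m + (\<alpha> - 1) * x / 2\<close> the same \<open>u\<close> equals \<open>m' * x + x\<^sup>2 / 2\<close>, which reduces the
  claim to the case \<open>\<alpha> = 1\<close>, Hoeffding's two-point estimate.\<close>

lemma two_point_tilt:
  fixes x m \<alpha> :: real
  assumes "0 \<le> x" "-1 \<le> m" "1 \<le> \<alpha>"
  defines "u \<equiv> m * x + \<alpha> * x\<^sup>2 / 2"
  shows "\<alpha> * cosh x + m * sinh x \<le> \<alpha> * cosh u + sinh u"
proof -
  define m' where "m' = m + (\<alpha> - 1) * x / 2"
  have m': "-1 \<le> m'" "u = m' * x + x\<^sup>2 / 2"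
  proof -
    have "0 \<le> (\<alpha> - 1) * x / 2" using assms by simp
    then show "-1 \<le> m'" using assms(2) by (simp only: m'_def)
    show "u = m' * x + x\<^sup>2 / 2" by (simp add: m'_def u_def field_simps power2_eq_square)
  qed
  have "\<alpha> * cosh x + m * sinh x = (\<alpha> - 1) * cosh x + (cosh x + m * sinh x)"
    by (simp add: algebra_simps)
  \<comment> \<open>The surplus \<open>(\<alpha> - 1) * x / 2 * sinh x\<close> moves the mean from
    \<open>m\<close> to \<open>m'\<close>. The remaining constant \<open>\<alpha> - 1\<close> is
    absorbed at the end by \<open>cosh u \<ge> 1\<close>.\<close>
  also have "\<dots> \<le> (\<alpha> - 1) * (1 + x / 2 * sinh x) + (cosh x + m * sinh x)"
    using assms cosh_le_one_plus_half_sinh[of x] by (intro add_right_mono mult_left_mono) auto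
  also have "\<dots> = (\<alpha> - 1) + (cosh x + m' * sinh x)"
    by (simp add: m'_def field_simps)
  also have "\<dots> \<le> (\<alpha> - 1) * cosh u + exp u"
    using assms cosh_real_ge_1[of u] cosh_plus_sinh_le_exp[OF assms(1) m'(1)] m'(2)
    by (intro add_mono) (auto simp: mult_le_cancel_left1)
  also have "\<dots> = \<alpha> * cosh u + sinh u"
    by (simp add: algebra_simps cosh_plus_sinh[symmetric])
  finally show ?thesis .
qed

text \<open>The sum of \<open>ln x\<close> and \<open>2 * (1 - x) / (1 + x)\<close> vanishes at 1
  and has a positive derivative before it. At \<open>x = l\<close> the fraction is
  \<open>2 / gap_alpha l\<close>.\<close>

lemma ln_less_two_div:
  fixes x :: real
  assumes "0 < x" "x < 1"
  shows "ln x < - (2 * (1 - x) / (1 + x))"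
proof -
  let ?\<phi> = "\<lambda>x::real. ln x + 2 * (1 - x) / (1 + x)"
  have "?\<phi> x < ?\<phi> 1"
  proof (rule DERIV_pos_imp_increasing_open[OF assms(2)])
    fix y :: real assume y: "x < y" "y < 1"
    have "(?\<phi> has_real_derivative (1 - y)\<^sup>2 / (y * (1 + y)\<^sup>2)) (at y)"
    proof -
      have "(?\<phi> has_real_derivative 1 / y + (- 2 * (1 + y) - 2 * (1 - y)) / ((1 + y) * (1 + y))) (at y)"
        using y assms by (auto intro!: derivative_eq_intros)
      also have "1 / y + (- 2 * (1 + y) - 2 * (1 - y)) / ((1 + y) * (1 + y))
          = (1 - y)\<^sup>2 / (y * (1 + y)\<^sup>2)"
        using y assms by (simp add: divide_simps power2_eq_square) (simp add: algebra_simps)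
      finally show ?thesis .
    qed
    moreover have "0 < (1 - y)\<^sup>2 / (y * (1 + y)\<^sup>2)" using y assms by simp
    ultimately show "\<exists>z. (?\<phi> has_real_derivative z) (at y) \<and> 0 < z" by blast
  next
    show "continuous_on {x..1} ?\<phi>" using assms by (auto intro!: continuous_intros)
  qed
  then show ?thesis by simp
qed

lemma gap_alpha_ge_1: "0 \<le> l \<Longrightarrow> l < 1 \<Longrightarrow> 1 \<le> gap_alpha l"
  by (simp add: gap_alpha_def)

lemma gap_alpha_mono: "0 \<le> l \<Longrightarrow> l \<le> l' \<Longrightarrow> l' < 1 \<Longrightarrow> gap_alpha l \<le> gap_alpha l'"
  by (simp add: gap_alpha_def frac_le)

text \<open>This keeps the denominators \<open>\<rho> - l * exp s\<close> positive for all
  \<open>s \<le> b\<close>. In logarithms, completing the square gives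
  \<open>b - 2 / \<alpha> \<le> \<alpha> * b\<^sup>2 / 8\<close>, and
  \<open>ln l < - (2 / \<alpha>)\<close> supplies the rest.\<close>

lemma lambda_exp_less:
  fixes a b l :: real
  assumes "0 \<le> l" "l < 1" "a \<le> 0" "0 \<le> b"
  shows "l * exp b < exp (gap_alpha l * (b - a)\<^sup>2 / 8)"
proof (cases "l = 0")
  case False
  define \<alpha> where "\<alpha> = gap_alpha l"
  have l: "0 < l" and \<alpha>: "1 \<le> \<alpha>" using False assms gap_alpha_ge_1 by (auto simp: \<alpha>_def)
  have "b\<^sup>2 \<le> (b - a)\<^sup>2" using assms by (intro power_mono) auto
  then have 1: "\<alpha> * b\<^sup>2 / 8 \<le> \<alpha> * (b - a)\<^sup>2 / 8" using \<alpha> by (simp add: mult_left_mono)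
  have "0 \<le> (\<alpha> * b - 4)\<^sup>2 / (8 * \<alpha>)" using \<alpha> by simp
  also have "\<dots> = \<alpha> * b\<^sup>2 / 8 - b + 2 / \<alpha>"
    using \<alpha> by (simp add: power2_eq_square field_simps)
  finally have 2: "b - 2 / \<alpha> \<le> \<alpha> * b\<^sup>2 / 8" by simp
  have "ln l < - (2 / \<alpha>)"
    using ln_less_two_div[OF l assms(2)] by (simp add: \<alpha>_def gap_alpha_def)
  then have "ln l + b < \<alpha> * (b - a)\<^sup>2 / 8" using 1 2 by linarith
  then have "exp (ln l + b) < exp (\<alpha> * (b - a)\<^sup>2 / 8)" by simp
  then show ?thesis using l by (simp add: exp_add \<alpha>_def)
qed simp

text \<open>The right-hand side minus the left-hand side is the characteristic polynomial at \<open>\<rho>\<close> of the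
  kernel \<open>l I + (1 - l) \<pi>\<close> on two points, tilted by the weights \<open>exp a\<close> and \<open>exp b\<close>.\<close>

lemma two_point_char_poly:
  fixes a b l :: real
  assumes "0 \<le> l" "l < 1" "a \<le> 0" "0 \<le> b" "a < b"
  defines "\<rho> \<equiv> exp (gap_alpha l * (b - a)\<^sup>2 / 8)"
  defines "q \<equiv> - a / (b - a)"
  shows "\<rho> * ((l + (1 - l) * (1 - q)) * exp a + (l + (1 - l) * q) * exp b)
           \<le> \<rho>\<^sup>2 + l * exp a * exp b"
proof -
  \<comment> \<open>\<open>q\<close> is the mass at \<open>b\<close> of the mean-zero law on the two
    endpoints. Rescaled to the values -1 and 1 this law has mean \<open>m\<close>, which places the
    endpoints at \<open>- (m * x) - x\<close> and \<open>- (m * x) + x\<close>.\<close>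
  define \<alpha> x m where "\<alpha> = gap_alpha l" and "x = (b - a) / 2" and "m = 2 * q - 1"
  define u where "u = m * x + \<alpha> * x\<^sup>2 / 2"
  have \<alpha>: "1 \<le> \<alpha>" "(1 - l) * \<alpha> = 1 + l"
    using assms gap_alpha_ge_1 by (auto simp: \<alpha>_def gap_alpha_def)
  have "0 \<le> q" using assms unfolding q_def by (intro divide_nonneg_pos) auto
  then have m: "-1 \<le> m" by (simp add: m_def)
  have x: "0 \<le> x" using assms by (simp add: x_def)
  have ab: "a = - (m * x) - x" "b = - (m * x) + x"
    using assms(5) by (auto simp: m_def x_def q_def field_simps)
  have q: "q = (1 + m) / 2" by (simp add: m_def)
  have "(b - a)\<^sup>2 / 8 = x\<^sup>2 / 2" by (simp add: x_def power2_eq_square)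
  then have \<rho>: "\<rho> = exp (- (m * x)) * exp u"
    unfolding \<rho>_def u_def \<alpha>_def[symmetric] by (simp flip: exp_add add: algebra_simps)
  define E where "E = exp (- (m * x))"
  have E: "exp a = E * exp (- x)" "exp b = E * exp x" "0 < E"
    by (auto simp: ab E_def simp flip: exp_add)
  \<comment> \<open>The factor \<open>1 - l\<close> clears the denominator of \<alpha>. In
    exponentials the right-hand side is \<open>exp u + l * exp (- u)\<close>, and multiplying by
    \<open>E\<^sup>2 * exp u\<close> turns it into
    \<open>\<rho>\<^sup>2 + l * exp a * exp b\<close>.\<close>
  have "(1 - l) * (\<alpha> * cosh x + m * sinh x) \<le> (1 - l) * (\<alpha> * cosh u + sinh u)"
    using two_point_tilt[OF x m \<alpha>(1)] assms(2) by (intro mult_left_mono) (auto simp: u_def)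
  then have "(1 + l) * cosh x + (1 - l) * m * sinh x \<le> (1 + l) * cosh u + (1 - l) * sinh u"
    unfolding \<alpha>(2)[symmetric] by (simp add: algebra_simps)
  moreover have "(1 + l) * cosh u + (1 - l) * sinh u = exp u + l * exp (- u)"
    by (simp add: cosh_field_def sinh_field_def field_simps)
  moreover have "(1 + l) * cosh x + (1 - l) * m * sinh x
      = (l + (1 - l) * (1 - q)) * exp (- x) + (l + (1 - l) * q) * exp x"
    by (simp add: cosh_field_def sinh_field_def q field_simps)
  ultimately have "(l + (1 - l) * (1 - q)) * exp (- x) + (l + (1 - l) * q) * exp x
      \<le> exp u + l * exp (- u)" by simp
  then have "E\<^sup>2 * exp u * ((l + (1 - l) * (1 - q)) * exp (- x) + (l + (1 - l) * q) * exp x)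
      \<le> E\<^sup>2 * exp u * (exp u + l * exp (- u))"
    by (intro mult_left_mono) auto
  also have "\<dots> = \<rho>\<^sup>2 + l * exp a * exp b"
    unfolding E \<rho> E_def[symmetric] by (simp add: power2_eq_square algebra_simps exp_minus)
  finally show ?thesis
    unfolding E \<rho> E_def[symmetric] by (simp add: power2_eq_square algebra_simps)
qed

text \<open>The weights \<open>b / (b - a)\<close> and \<open>- a / (b - a)\<close> form the
  mean-zero law on the endpoints. The denominators are positive by \<open>lambda_exp_less\<close>,
  and clearing them leaves exactly \<open>two_point_char_poly\<close>.\<close>

lemma two_point_resolvent:
  fixes a b l :: real
  assumes "0 \<le> l" "l < 1" "a \<le> 0" "0 \<le> b" "a < b"
  defines "\<rho> \<equiv> exp (gap_alpha l * (b - a)\<^sup>2 / 8)"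
  shows "b / (b - a) * ((1 - l) * exp a / (\<rho> - l * exp a))
           - a / (b - a) * ((1 - l) * exp b / (\<rho> - l * exp b)) \<le> 1"
proof -
  define q where "q = - a / (b - a)"
  have q: "b / (b - a) = 1 - q" "- a / (b - a) = q" using assms(5) by (auto simp: q_def field_simps)
  have B: "l * exp b < \<rho>" unfolding \<rho>_def by (intro lambda_exp_less assms)
  moreover have "l * exp a \<le> l * exp b" using assms by (intro mult_left_mono) auto
  ultimately have A: "l * exp a < \<rho>" by simp
  have *: "\<rho> * ((l + (1 - l) * (1 - q)) * exp a + (l + (1 - l) * q) * exp b)
           \<le> \<rho>\<^sup>2 + l * exp a * exp b"
    unfolding \<rho>_def q_def by (intro two_point_char_poly assms)
  have "(1 - q) * ((1 - l) * exp a / (\<rho> - l * exp a)) + q * ((1 - l) * exp b / (\<rho> - l * exp b))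
      = ((1 - q) * (1 - l) * exp a * (\<rho> - l * exp b) + q * (1 - l) * exp b * (\<rho> - l * exp a))
        / ((\<rho> - l * exp a) * (\<rho> - l * exp b))"
    using A B by (simp add: add_frac_eq)
  also have "\<dots> \<le> 1"
  proof -
    have "(1 - q) * (1 - l) * exp a * (\<rho> - l * exp b) + q * (1 - l) * exp b * (\<rho> - l * exp a)
        \<le> (\<rho> - l * exp a) * (\<rho> - l * exp b)"
      using * by (simp add: algebra_simps power2_eq_square)
    then show ?thesis using A B by (subst divide_le_eq_1_pos) auto
  qed
  finally show ?thesis unfolding q(1) q(2)[symmetric] by simp
qed

section \<open>Convexity: from an interval to its endpoints\<close>

lemma exp_chord:
  fixes a b s :: real
  assumes "a < b" "s \<in> {a..b}"
  shows "exp s \<le> (b - s) / (b - a) * exp a + (s - a) / (b - a) * exp b"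
proof -
  define y where "y = (s - a) / (b - a)"
  have y: "y \<in> {0..1}" "1 - y = (b - s) / (b - a)"
    using assms by (auto simp: y_def field_simps)
  have "y * (b - a) = s - a" using assms by (simp add: y_def)
  then have y3: "s = (1 - y) * a + y * b" by (simp add: algebra_simps)
  have "exp (1 * ((1 - y) *\<^sub>R a + y *\<^sub>R b)) \<le> (1 - y) * exp (1 * a) + y * exp (1 * b)"
    using y by (intro convex_onD[OF convex_on_exp]) auto
  then show ?thesis using y3 unfolding y(2) by (simp add: y_def)
qed

text \<open>Two chord bounds are composed: \<open>exp s\<close> lies below its chord value
  \<open>Y\<close>, and \<open>z / (\<rho> - l * z)\<close> is increasing and convex in
  \<open>z\<close> as long as \<open>l * z < \<rho>\<close>.\<close>

lemma resolvent_chord: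
  fixes a b l \<rho> s :: real
  assumes "a < b" "s \<in> {a..b}" "0 \<le> l" "l < 1" "0 < \<rho>" "l * exp b < \<rho>"
  shows "(1 - l) * exp s / (\<rho> - l * exp s)
      \<le> (b - s) / (b - a) * ((1 - l) * exp a / (\<rho> - l * exp a))
        + (s - a) / (b - a) * ((1 - l) * exp b / (\<rho> - l * exp b))"
proof -
  define y where "y = (s - a) / (b - a)"
  have y: "0 \<le> y" "y \<le> 1" "(b - s) / (b - a) = 1 - y"
    using assms by (auto simp: y_def field_simps)
  define A B Y where "A = exp a" "B = exp b" "Y = (1 - y) * exp a + y * exp b"
  have pos: "l * A < \<rho>" "l * B < \<rho>"
  proof -
    have "l * A \<le> l * B" using assms by (intro mult_left_mono) (auto simp: A_B_Y_def)
    then show "l * A < \<rho>" "l * B < \<rho>" using assms by (auto simp: A_B_Y_def)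
  qed
  have "\<rho> - l * Y = (1 - y) * (\<rho> - l * A) + y * (\<rho> - l * B)"
    by (simp add: A_B_Y_def algebra_simps)
  also have "\<dots> > 0"
    using y pos by (cases "y = 0") (auto intro!: add_nonneg_pos mult_nonneg_nonneg)
  finally have Y: "l * Y < \<rho>" by simp
  have sY: "exp s \<le> Y"
    using exp_chord[OF assms(1,2)] y by (simp add: A_B_Y_def y_def)
  have lsY: "l * exp s \<le> l * Y" using sY assms by (intro mult_left_mono)
  have Y0: "0 \<le> Y" using sY exp_ge_zero[of s] by linarith
  have "(1 - l) * exp s / (\<rho> - l * exp s) \<le> (1 - l) * Y / (\<rho> - l * Y)"
    using sY lsY Y Y0 assms by (intro frac_le mult_left_mono mult_nonneg_nonneg) auto
  also have "\<dots> = (1 - l) * (Y / (\<rho> - l * Y))" by simp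
  also have "\<dots> \<le> (1 - l) * ((1 - y) * (A / (\<rho> - l * A)) + y * (B / (\<rho> - l * B)))"
  proof (intro mult_left_mono)
    \<comment> \<open>Convexity is read off from a closed formula for the gap between chord and
      graph, all of whose factors are nonnegative.\<close>
    have "(1 - y) * (A / (\<rho> - l * A)) + y * (B / (\<rho> - l * B)) - Y / (\<rho> - l * Y)
        = y * (1 - y) * l * \<rho> * (B - A)\<^sup>2 / ((\<rho> - l * A) * (\<rho> - l * B) * (\<rho> - l * Y))"
    proof -
      have Yd: "Y = (1 - y) * A + y * B" by (simp add: A_B_Y_def)
      have nz: "\<rho> - l * A \<noteq> 0" "\<rho> - l * B \<noteq> 0" "\<rho> - l * Y \<noteq> 0" using pos Y by auto
      have "(1 - y) * (A / (\<rho> - l * A)) + y * (B / (\<rho> - l * B)) - Y / (\<rho> - l * Y)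
         = ((1 - y) * A * (\<rho> - l * B) * (\<rho> - l * Y) + y * B * (\<rho> - l * A) * (\<rho> - l * Y)
            - Y * (\<rho> - l * A) * (\<rho> - l * B)) / ((\<rho> - l * A) * (\<rho> - l * B) * (\<rho> - l * Y))"
        using nz by (simp add: divide_simps) (simp add: algebra_simps)
      also have "(1 - y) * A * (\<rho> - l * B) * (\<rho> - l * Y) + y * B * (\<rho> - l * A) * (\<rho> - l * Y)
            - Y * (\<rho> - l * A) * (\<rho> - l * B) = y * (1 - y) * l * \<rho> * (B - A)\<^sup>2"
        unfolding Yd by algebra
      finally show ?thesis .
    qed
    also have "\<dots> \<ge> 0" using y pos Y assms by (intro divide_nonneg_nonneg mult_nonneg_nonneg) auto
    finally show "Y / (\<rho> - l * Y) \<le> (1 - y) * (A / (\<rho> - l * A)) + y * (B / (\<rho> - l * B))" by simp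
  qed (use assms in auto)
  finally show ?thesis
    unfolding y(3) y_def[symmetric] by (simp add: A_B_Y_def algebra_simps)
qed

section \<open>The Leon-Perron form under exponential tilting\<close>

text \<open>The integral of \<open>(s * u x - r * v x)\<^sup>2\<close> is a nonnegative quadratic
  form in \<open>s\<close> and \<open>r\<close>. Its value at \<open>s = V\<close>,
  \<open>r = C\<close> is \<open>V * (U * V - C\<^sup>2)\<close>.\<close>

lemma Cauchy_Schwarz_integral:
  fixes u v :: "'a \<Rightarrow> real"
  assumes "integrable N (\<lambda>x. (u x)\<^sup>2)" "integrable N (\<lambda>x. (v x)\<^sup>2)" "integrable N (\<lambda>x. u x * v x)"
  shows "(\<integral>x. u x * v x \<partial>N)\<^sup>2 \<le> (\<integral>x. (u x)\<^sup>2 \<partial>N) * (\<integral>x. (v x)\<^sup>2 \<partial>N)"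
proof -
  define U V C where "U = (\<integral>x. (u x)\<^sup>2 \<partial>N)" and "V = (\<integral>x. (v x)\<^sup>2 \<partial>N)" and "C = (\<integral>x. u x * v x \<partial>N)"
  have quad: "0 \<le> s\<^sup>2 * U - 2 * s * r * C + r\<^sup>2 * V" for s r :: real
  proof -
    have "0 \<le> (\<integral>x. (s * u x - r * v x)\<^sup>2 \<partial>N)" by simp
    also have "\<dots> = (\<integral>x. s\<^sup>2 * (u x)\<^sup>2 - 2 * s * r * (u x * v x) + r\<^sup>2 * (v x)\<^sup>2 \<partial>N)"
      by (rule arg_cong[where f = "integral\<^sup>L N"]) (auto simp: power2_eq_square algebra_simps)
    also have "\<dots> = s\<^sup>2 * U - 2 * s * r * C + r\<^sup>2 * V"
      using assms by (simp add: U_def V_def C_def)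
    finally show ?thesis .
  qed
  have nn: "0 \<le> U" "0 \<le> V" by (auto simp: U_def V_def)
  have "C\<^sup>2 \<le> U * V"
  proof (cases "V = 0")
    case True
    \<comment> \<open>For \<open>V = 0\<close> the form is affine in \<open>r\<close>, so a nonzero
      slope would make it negative; \<open>r = (U + 1) / C\<close> already does.\<close>
    have "C = 0"
    proof (rule ccontr)
      assume "C \<noteq> 0"
      then have "0 \<le> U - 2 * ((U + 1) / C) * C" using quad[of 1 "(U + 1) / C"] True by simp
      also have "\<dots> = - U - 2" using \<open>C \<noteq> 0\<close> by simp
      finally show False using nn by simp
    qed
    then show ?thesis using True by simp
  next
    case False
    then have "0 < V" using nn by simp
    moreover have "0 \<le> V * (U * V - C\<^sup>2)"
      using quad[of V C] by (simp add: power2_eq_square algebra_simps)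
    ultimately show ?thesis by (simp add: zero_le_mult_iff)
  qed
  then show ?thesis by (simp add: U_def V_def C_def)
qed

text \<open>The bound holds at every point and not just almost everywhere, so the class depends only
  on the sigma-algebra. A function therefore stays in it when \<pi> is replaced by any
  \<open>P x\<close>, for which \<pi>-null sets may be visible.\<close>

definition bounded_measurable :: "'a measure \<Rightarrow> ('a \<Rightarrow> real) set" where
  "bounded_measurable N = {h \<in> borel_measurable N. \<exists>K. \<forall>x\<in>space N. \<bar>h x\<bar> \<le> K}"

section \<open>Closure properties of bounded measurable functions\<close>

lemma bounded_measurableI:
  "h \<in> borel_measurable N \<Longrightarrow> (\<And>x. x \<in> space N \<Longrightarrow> \<bar>h x\<bar> \<le> K) \<Longrightarrow> h \<in> bounded_measurable N"
  by (auto simp: bounded_measurable_def)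

lemma bounded_measurableD: "h \<in> bounded_measurable N \<Longrightarrow> h \<in> borel_measurable N"
  by (auto simp: bounded_measurable_def)

lemma bounded_measurable_bound:
  assumes "h \<in> bounded_measurable N"
  obtains K where "0 \<le> K" "\<And>x. x \<in> space N \<Longrightarrow> \<bar>h x\<bar> \<le> K"
proof -
  from assms obtain K where "\<And>x. x \<in> space N \<Longrightarrow> \<bar>h x\<bar> \<le> K" by (auto simp: bounded_measurable_def)
  then show thesis by (intro that[of "max 0 K"]) (auto simp: le_max_iff_disj)
qed

lemma bounded_measurable_sets_cong:
  "sets N = sets N' \<Longrightarrow> bounded_measurable N = bounded_measurable N'"
  by (simp add: bounded_measurable_def cong: measurable_cong_sets sets_eq_imp_space_eq)

lemma bounded_measurable_const [simp]: "(\<lambda>x. c) \<in> bounded_measurable N"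
  by (auto simp: bounded_measurable_def)

lemma bounded_measurable_mult:
  assumes "u \<in> bounded_measurable N" "v \<in> bounded_measurable N"
  shows "(\<lambda>x. u x * v x) \<in> bounded_measurable N"
proof -
  obtain K L where "0 \<le> K" "\<And>x. x \<in> space N \<Longrightarrow> \<bar>u x\<bar> \<le> K" "0 \<le> L" "\<And>x. x \<in> space N \<Longrightarrow> \<bar>v x\<bar> \<le> L"
    using assms by (metis bounded_measurable_bound)
  then show ?thesis
    using assms[THEN bounded_measurableD]
    by (intro bounded_measurableI[where K = "K * L"]) (auto simp: abs_mult intro!: mult_mono)
qed

lemma bounded_measurable_diff:
  assumes "u \<in> bounded_measurable N" "v \<in> bounded_measurable N"
  shows "(\<lambda>x. u x - v x) \<in> bounded_measurable N"
proof -
  obtain K L where "\<And>x. x \<in> space N \<Longrightarrow> \<bar>u x\<bar> \<le> K" "\<And>x. x \<in> space N \<Longrightarrow> \<bar>v x\<bar> \<le> L"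
    using assms by (metis bounded_measurable_bound)
  then show ?thesis
    using assms[THEN bounded_measurableD]
    by (intro bounded_measurableI[where K = "K + L"]) (auto intro!: order_trans[OF abs_triangle_ineq4] add_mono)
qed

lemma bounded_measurable_sum:
  assumes "\<And>i. i \<in> I \<Longrightarrow> u i \<in> bounded_measurable N"
  shows "(\<lambda>x. \<Sum>i\<in>I. u i x) \<in> bounded_measurable N"
  using assms
proof (induction I rule: infinite_finite_induct)
  case (insert i I)
  \<comment> \<open>Addition is expressed by two subtractions, for which closure has been
    shown.\<close>
  then have "(\<lambda>x. u i x - (0 - (\<Sum>i\<in>I. u i x))) \<in> bounded_measurable N"
    by (intro bounded_measurable_diff) auto
  then show ?case using insert by simp
qed auto

lemma bounded_measurable_exp:
  assumes "u \<in> bounded_measurable N"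
  shows "(\<lambda>x. exp (u x)) \<in> bounded_measurable N"
proof -
  obtain K where "\<And>x. x \<in> space N \<Longrightarrow> \<bar>u x\<bar> \<le> K"
    using assms by (metis bounded_measurable_bound)
  then show ?thesis
    using bounded_measurableD[OF assms] by (intro bounded_measurableI[where K = "exp K"]) (auto dest: abs_le_D1)
qed

lemma bounded_measurable_exp_half:
  "u \<in> bounded_measurable N \<Longrightarrow> (\<lambda>x. exp (u x / 2)) \<in> bounded_measurable N"
  using bounded_measurable_exp[OF bounded_measurable_mult[OF bounded_measurable_const[of "1 / 2"]], of u N]
  by simp

lemma bounded_measurable_interval:
  assumes "u \<in> borel_measurable N" "\<And>x. x \<in> space N \<Longrightarrow> u x \<in> {a..b}"
  shows "u \<in> bounded_measurable N"
  using assms by (intro bounded_measurableI[where K = "max \<bar>a\<bar> \<bar>b\<bar>"]) fastforce+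

lemma bounded_measurable_comp:
  assumes "u \<in> bounded_measurable N" "X \<in> M \<rightarrow>\<^sub>M N"
  shows "(\<lambda>x. u (X x)) \<in> bounded_measurable M"
  using assms measurable_space[OF assms(2)] by (auto simp: bounded_measurable_def) 

lemmas bounded_measurable_intros =
  bounded_measurable_const bounded_measurable_mult bounded_measurable_diff
  bounded_measurable_sum bounded_measurable_exp

lemma bounded_measurable_power2:
  "u \<in> bounded_measurable N \<Longrightarrow> (\<lambda>x. (u x)\<^sup>2) \<in> bounded_measurable N"
  unfolding power2_eq_square by (rule bounded_measurable_mult)

lemma (in finite_measure) integrable_bounded_measurable:
  assumes "u \<in> bounded_measurable M"
  shows "integrable M u"
proof -
  obtain K where "\<And>x. x \<in> space M \<Longrightarrow> \<bar>u x\<bar> \<le> K"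
    using assms by (metis bounded_measurable_bound)
  then show ?thesis
    using bounded_measurableD[OF assms] by (intro integrable_const_bound[where B = K]) auto
qed

text \<open>The quadratic form of the Leon-Perron operator \<open>l I + (1 - l) \<pi>\<close>.\<close>

definition leon_perron_form :: "'a measure \<Rightarrow> real \<Rightarrow> ('a \<Rightarrow> real) \<Rightarrow> real" where
  "leon_perron_form N l h = l * (\<integral>x. (h x)\<^sup>2 \<partial>N) + (1 - l) * (\<integral>x. h x \<partial>N)\<^sup>2"

text \<open>The chord bound is affine in \<open>f x\<close>. Integrating it under mean zero leaves
  the two-point value, which \<open>two_point_resolvent\<close> bounds by 1.\<close>

lemma (in prob_space) integral_resolvent_le_1:
  fixes f :: "'a \<Rightarrow> real"
  assumes l: "0 \<le> l" "l < 1" and f: "f \<in> borel_measurable M"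
    and ab: "\<And>x. x \<in> space M \<Longrightarrow> f x \<in> {a..b}" "a < b" and E0: "(\<integral>x. f x \<partial>M) = 0"
  defines "\<rho> \<equiv> exp (gap_alpha l * (b - a)\<^sup>2 / 8)"
  shows "(\<integral>x. (1 - l) * exp (f x) / (\<rho> - l * exp (f x)) \<partial>M) \<le> 1"
    and "a \<le> 0" "0 \<le> b"
proof -
  have fi: "integrable M f"
    using f ab(1) by (intro integrable_bounded_measurable bounded_measurable_interval)
  have "a \<le> (\<integral>x. f x \<partial>M)" "(\<integral>x. f x \<partial>M) \<le> b"
    using ab(1) fi by (auto intro!: integral_ge_const integral_le_const AE_I2)
  then show a: "a \<le> 0" and b: "0 \<le> b" using E0 by auto
  have \<rho>: "l * exp b < \<rho>" unfolding \<rho>_def by (intro lambda_exp_less l a b)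
  define A B where "A = (1 - l) * exp a / (\<rho> - l * exp a)" and "B = (1 - l) * exp b / (\<rho> - l * exp b)"
  have "(\<integral>x. (1 - l) * exp (f x) / (\<rho> - l * exp (f x)) \<partial>M)
      \<le> (\<integral>x. (b - f x) / (b - a) * A + (f x - a) / (b - a) * B \<partial>M)"
  \<comment> \<open>This rule asks for an integrable, nonnegative majorant, hence the second goal at
    each point.\<close>
  proof (rule integral_mono')
    fix x assume x: "x \<in> space M"
    show "(1 - l) * exp (f x) / (\<rho> - l * exp (f x)) \<le> (b - f x) / (b - a) * A + (f x - a) / (b - a) * B"
      unfolding A_def B_def using ab x l \<rho> by (intro resolvent_chord) (auto simp: \<rho>_def)
    have "l * exp (f x) \<le> l * exp b" using ab(1)[OF x] l by (intro mult_left_mono) auto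
    then have "0 \<le> (1 - l) * exp (f x) / (\<rho> - l * exp (f x))"
      using \<rho> l by (intro divide_nonneg_nonneg mult_nonneg_nonneg) auto
    also note \<open>(1 - l) * exp (f x) / (\<rho> - l * exp (f x)) \<le> (b - f x) / (b - a) * A + (f x - a) / (b - a) * B\<close>
    finally show "0 \<le> (b - f x) / (b - a) * A + (f x - a) / (b - a) * B" .
  qed (use fi in auto)
  also have "\<dots> = b / (b - a) * A - a / (b - a) * B"
    using fi E0 by (simp add: prob_space)
  also have "\<dots> \<le> 1"
    unfolding A_def B_def \<rho>_def by (intro two_point_resolvent l a b ab)
  finally show "(\<integral>x. (1 - l) * exp (f x) / (\<rho> - l * exp (f x)) \<partial>M) \<le> 1" .
qed

text \<open>With the weight \<open>w = \<rho> * exp (- f) - l\<close> the claim says that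
  \<open>(1 - l)\<close> times the squared integral of \<open>h\<close> is at most the integral of
  \<open>h\<^sup>2 * w\<close>. Cauchy-Schwarz for the product of \<open>h * sqrt w\<close> and
  \<open>1 / sqrt w\<close> reduces this to \<open>(1 - l)\<close> times the integral of
  \<open>1 / w\<close> being at most 1.\<close>

lemma (in prob_space) leon_perron_form_tilt:
  fixes f h :: "'a \<Rightarrow> real"
  assumes l: "0 \<le> l" "l < 1" and f: "f \<in> borel_measurable M"
    and ab: "\<And>x. x \<in> space M \<Longrightarrow> f x \<in> {a..b}" and E0: "(\<integral>x. f x \<partial>M) = 0"
    and h: "h \<in> bounded_measurable M"
  shows "leon_perron_form M l h \<le> exp (gap_alpha l * (b - a)\<^sup>2 / 8) * (\<integral>x. (h x)\<^sup>2 * exp (- f x) \<partial>M)"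
proof -
  have h2: "(\<lambda>x. (h x)\<^sup>2) \<in> bounded_measurable M" using h by (rule bounded_measurable_power2)
  have fb: "f \<in> bounded_measurable M"
    using f ab by (rule bounded_measurable_interval)
  note bm = bounded_measurable_intros fb h h2
  note [simp] = integrable_bounded_measurable[OF h] integrable_bounded_measurable[OF h2]
  show ?thesis
  proof (cases "a < b")
    \<comment> \<open>A one-point interval has no chord. Mean zero then forces \<open>f = 0\<close>
      and the exponential factor is 1, so Jensen's inequality suffices.\<close>
    case False
    obtain x0 where "x0 \<in> space M" using not_empty by blast
    then have "a = b" using ab[of x0] False by auto
    then have fa: "\<And>x. x \<in> space M \<Longrightarrow> f x = a" using ab by fastforce
    then have "(\<integral>x. f x \<partial>M) = (\<integral>x. a \<partial>M)" by (intro Bochner_Integration.integral_cong) auto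
    then have "a = 0" using E0 by (simp add: prob_space)
    then have "(\<integral>x. (h x)\<^sup>2 * exp (- f x) \<partial>M) = (\<integral>x. (h x)\<^sup>2 \<partial>M)"
      using fa by (intro Bochner_Integration.integral_cong) auto
    moreover have "(\<integral>x. h x \<partial>M)\<^sup>2 \<le> (\<integral>x. (h x)\<^sup>2 \<partial>M)"
      using Cauchy_Schwarz_integral[of M h "\<lambda>_. 1"] by (simp add: prob_space)
    then have "(1 - l) * (\<integral>x. h x \<partial>M)\<^sup>2 \<le> (1 - l) * (\<integral>x. (h x)\<^sup>2 \<partial>M)"
      using l by (intro mult_left_mono) auto
    then have "leon_perron_form M l h \<le> (\<integral>x. (h x)\<^sup>2 \<partial>M)"
      by (simp add: leon_perron_form_def algebra_simps)
    ultimately show ?thesis using \<open>a = b\<close> by simp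
  next
    case True
    define \<rho> where "\<rho> = exp (gap_alpha l * (b - a)\<^sup>2 / 8)"
    define w where "w x = \<rho> * exp (- f x) - l" for x
    note R = integral_resolvent_le_1[OF l f ab True E0, folded \<rho>_def]
    have \<rho>: "l * exp b < \<rho>" unfolding \<rho>_def by (intro lambda_exp_less l R)
    \<comment> \<open>The value of the weight at the upper endpoint is a positive lower bound for
      \<open>w\<close>, which makes \<open>1 / w\<close> bounded.\<close>
    define \<delta> where "\<delta> = \<rho> * exp (- b) - l"
    have \<delta>: "0 < \<delta>" using \<rho> by (simp add: \<delta>_def exp_minus field_simps)
    have w: "\<delta> \<le> w x" if "x \<in> space M" for x
      using ab[OF that] by (auto simp: w_def \<delta>_def \<rho>_def)
    have wb: "w \<in> bounded_measurable M"
    proof -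
      have "(\<lambda>x. \<rho> * exp (0 - f x) - l) \<in> bounded_measurable M" by (intro bm)
      then show ?thesis by (simp add: w_def[abs_def])
    qed
    have wm [measurable]: "w \<in> borel_measurable M" using wb by (rule bounded_measurableD)
    have iw: "(\<lambda>x. 1 / w x) \<in> bounded_measurable M"
    proof (rule bounded_measurableI[where K = "1 / \<delta>"])
      fix x assume "x \<in> space M"
      then show "\<bar>1 / w x\<bar> \<le> 1 / \<delta>" using w[of x] \<delta> by (auto simp: frac_le)
    qed measurable
    have hw: "(\<lambda>x. (h x)\<^sup>2 * w x) \<in> bounded_measurable M" by (intro bm wb)
    define u v where "u x = h x * sqrt (w x)" and "v x = 1 / sqrt (w x)" for x
    have wpos: "0 < w x" if "x \<in> space M" for x using w[OF that] \<delta> by simp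
    have e: "(u x)\<^sup>2 = (h x)\<^sup>2 * w x" "(v x)\<^sup>2 = 1 / w x" "u x * v x = h x" if "x \<in> space M" for x
      using wpos[OF that] by (auto simp: u_def v_def power_mult_distrib power_divide)
    have "(\<integral>x. u x * v x \<partial>M)\<^sup>2 \<le> (\<integral>x. (u x)\<^sup>2 \<partial>M) * (\<integral>x. (v x)\<^sup>2 \<partial>M)"
      by (rule Cauchy_Schwarz_integral)
         (simp_all add: e integrable_bounded_measurable hw iw cong: Bochner_Integration.integrable_cong)
    then have CS: "(\<integral>x. h x \<partial>M)\<^sup>2 \<le> (\<integral>x. (h x)\<^sup>2 * w x \<partial>M) * (\<integral>x. 1 / w x \<partial>M)"
      by (simp add: e cong: Bochner_Integration.integral_cong)
    have "(1 - l) * (1 / w x) = (1 - l) * exp (f x) / (\<rho> - l * exp (f x))" if "x \<in> space M" for x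
    proof -
      have "w x = (\<rho> - l * exp (f x)) / exp (f x)" by (simp add: w_def exp_minus field_simps)
      then show ?thesis by simp
    qed
    then have "(1 - l) * (\<integral>x. 1 / w x \<partial>M) = (\<integral>x. (1 - l) * exp (f x) / (\<rho> - l * exp (f x)) \<partial>M)"
      by (subst integral_mult_right_zero[symmetric]) (rule Bochner_Integration.integral_cong; simp)
    then have iw1: "(1 - l) * (\<integral>x. 1 / w x \<partial>M) \<le> 1" using R(1) by simp
    have "(1 - l) * (\<integral>x. h x \<partial>M)\<^sup>2 \<le> (1 - l) * ((\<integral>x. (h x)\<^sup>2 * w x \<partial>M) * (\<integral>x. 1 / w x \<partial>M))"
      using CS l by (intro mult_left_mono) auto
    also have "\<dots> = (\<integral>x. (h x)\<^sup>2 * w x \<partial>M) * ((1 - l) * (\<integral>x. 1 / w x \<partial>M))" by simp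
    also have "\<dots> \<le> (\<integral>x. (h x)\<^sup>2 * w x \<partial>M)"
      using iw1 wpos by (intro mult_left_le integral_nonneg_AE AE_I2 mult_nonneg_nonneg less_imp_le[OF wpos]) auto
    also have "\<dots> = (\<integral>x. \<rho> * ((h x)\<^sup>2 * exp (- f x)) - l * (h x)\<^sup>2 \<partial>M)"
      by (intro Bochner_Integration.integral_cong) (auto simp: w_def algebra_simps)
    also have "\<dots> = \<rho> * (\<integral>x. (h x)\<^sup>2 * exp (- f x) \<partial>M) - l * (\<integral>x. (h x)\<^sup>2 \<partial>M)"
    proof -
      have "(\<lambda>x. (h x)\<^sup>2 * exp (0 - f x)) \<in> bounded_measurable M" by (intro bm)
      then show ?thesis by (subst Bochner_Integration.integral_diff) (auto intro: integrable_bounded_measurable)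
    qed
    finally show ?thesis by (simp add: leon_perron_form_def \<rho>_def)
  qed
qed

section \<open>Kernels with a spectral gap\<close>

lemma L2_norm_nonneg [simp]: "0 \<le> L2_norm N h"
  by (simp add: L2_norm_def)

lemma L2_norm_power2: "(L2_norm N h)\<^sup>2 = (\<integral>x. (h x)\<^sup>2 \<partial>N)"
  by (simp add: L2_norm_def)

lemma L2_norm_cmult: "L2_norm N (\<lambda>x. c * h x) = \<bar>c\<bar> * L2_norm N h"
  by (simp add: L2_norm_def power_mult_distrib real_sqrt_mult)

lemma L2_norm_Cauchy_Schwarz:
  assumes "integrable N (\<lambda>x. (u x)\<^sup>2)" "integrable N (\<lambda>x. (v x)\<^sup>2)" "integrable N (\<lambda>x. u x * v x)"
  shows "\<bar>\<integral>x. u x * v x \<partial>N\<bar> \<le> L2_norm N u * L2_norm N v"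
  using real_sqrt_le_mono[OF Cauchy_Schwarz_integral[OF assms]]
  by (simp add: L2_norm_def real_sqrt_mult)

text \<open>Jensen's inequality for arbitrary \<open>h\<close>: if the square of a measurable
  \<open>h\<close> is not integrable the right-hand side is infinite, and if \<open>h\<close> is not
  measurable its Bochner integral is 0. This generality serves the measures \<open>P x\<close>,
  under which a function from \<open>L2_fun \<pi>\<close> may fail to be square-integrable.\<close>

lemma (in prob_space) power2_integral_le_nn_integral:
  "ennreal ((\<integral>x. h x \<partial>M)\<^sup>2) \<le> (\<integral>\<^sup>+x. ennreal ((h x)\<^sup>2) \<partial>M)"
proof (cases "h \<in> borel_measurable M \<and> integrable M (\<lambda>x. (h x)\<^sup>2)")
  case True
  then have h: "integrable M h" using square_integrable_imp_integrable by blast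
  have "(\<integral>x. h x \<partial>M)\<^sup>2 \<le> (\<integral>x. (h x)\<^sup>2 \<partial>M)"
    using Cauchy_Schwarz_integral[of M h "\<lambda>_. 1"] True h by (simp add: prob_space)
  moreover have "(\<integral>\<^sup>+x. ennreal ((h x)\<^sup>2) \<partial>M) = ennreal (\<integral>x. (h x)\<^sup>2 \<partial>M)"
    using True by (intro nn_integral_eq_integral) auto
  ultimately show ?thesis by (simp add: ennreal_leI)
next
  case False
  show ?thesis
  proof (cases "h \<in> borel_measurable M")
    case True
    then have "\<not> (\<integral>\<^sup>+x. ennreal ((h x)\<^sup>2) \<partial>M) < \<infinity>"
      using False by (auto simp: integrable_iff_bounded)
    then show ?thesis by (simp add: not_less top_unique)
  next
    case False
    then have "\<not> integrable M h" by auto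
    then show ?thesis by (simp add: not_integrable_integral_eq)
  qed
qed

section \<open>Invariant kernels as operators\<close>

locale invariant_markov_kernel = prob_space \<pi> for \<pi> :: "'a measure" +
  fixes P :: "'a \<Rightarrow> 'a measure"
  assumes kernel: "P \<in> \<pi> \<rightarrow>\<^sub>M prob_algebra \<pi>"
    and invariant: "invariant_kernel \<pi> P"
begin

lemma kernel_subprob [measurable]: "P \<in> \<pi> \<rightarrow>\<^sub>M subprob_algebra \<pi>"
  using kernel by (rule measurable_prob_algebraD)

lemma kernel_at:
  assumes "x \<in> space \<pi>"
  shows "prob_space (P x)" "sets (P x) = sets \<pi>" "space (P x) = space \<pi>"
  using measurable_space[OF kernel assms] by (auto simp: space_prob_algebra dest: sets_eq_imp_space_eq)

text \<open>Invariance as a fixed-point equation for \<open>bind\<close>, so that the integration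
  rule for \<open>bind\<close> applies to iterated integrals.\<close>

lemma bind_kernel: "\<pi> \<bind> P = \<pi>"
proof (rule measure_eqI)
  show "sets (\<pi> \<bind> P) = sets \<pi>" by (rule sets_bind) (auto simp: kernel_at not_empty)
next
  fix B assume "B \<in> sets (\<pi> \<bind> P)"
  then have B: "B \<in> sets \<pi>" by (subst (asm) sets_bind) (auto simp: kernel_at not_empty)
  have "emeasure (\<pi> \<bind> P) B = (\<integral>\<^sup>+x. emeasure (P x) B \<partial>\<pi>)"
    by (rule emeasure_bind[OF not_empty kernel_subprob B])
  also have "\<dots> = emeasure \<pi> B" using invariant B by (simp add: invariant_kernel_def)
  finally show "emeasure (\<pi> \<bind> P) B = emeasure \<pi> B" .
qed

lemma nn_integral_kernel:
  "h \<in> borel_measurable \<pi> \<Longrightarrow> (\<integral>\<^sup>+x. \<integral>\<^sup>+y. h y \<partial>P x \<partial>\<pi>) = (\<integral>\<^sup>+x. h x \<partial>\<pi>)"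
  using nn_integral_bind[of h \<pi> P \<pi>] kernel_subprob bind_kernel by simp

lemma bounded_measurable_kernel:
  "x \<in> space \<pi> \<Longrightarrow> h \<in> bounded_measurable \<pi> \<Longrightarrow> h \<in> bounded_measurable (P x)"
  using bounded_measurable_sets_cong[OF kernel_at(2)] by simp

lemma integrable_kernel:
  assumes "x \<in> space \<pi>" "h \<in> bounded_measurable \<pi>"
  shows "integrable (P x) h"
proof -
  interpret Px: prob_space "P x" by (rule kernel_at assms)+
  show ?thesis by (rule Px.integrable_bounded_measurable[OF bounded_measurable_kernel[OF assms]])
qed

lemma markov_op_bounded_measurable:
  assumes h: "h \<in> bounded_measurable \<pi>"
  shows "markov_op P h \<in> bounded_measurable \<pi>"
proof -
  obtain K where K: "0 \<le> K" "\<And>x. x \<in> space \<pi> \<Longrightarrow> \<bar>h x\<bar> \<le> K"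
    using h by (metis bounded_measurable_bound)
  have "(\<lambda>N. integral\<^sup>L N h) \<in> borel_measurable (subprob_algebra \<pi>)"
    by (rule integral_measurable_subprob_algebra) (rule bounded_measurableD[OF h])
  from measurable_compose[OF kernel_subprob this]
  have m: "markov_op P h \<in> borel_measurable \<pi>" by (simp add: markov_op_def[abs_def])
  show ?thesis
  proof (rule bounded_measurableI[OF m])
    fix x assume x: "x \<in> space \<pi>"
    interpret Px: prob_space "P x" by (rule kernel_at x)+
    note i = integrable_kernel[OF x h]
    have "\<bar>markov_op P h x\<bar> \<le> (\<integral>y. \<bar>h y\<bar> \<partial>P x)"
      unfolding markov_op_def by (rule integral_abs_bound)
    also have "\<dots> \<le> K"
      using i K(2) kernel_at(3)[OF x] by (intro Px.integral_le_const AE_I2) auto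
    finally show "\<bar>markov_op P h x\<bar> \<le> K" .
  qed
qed

lemma markov_op_mono_nonneg:
  assumes "x \<in> space \<pi>" "\<And>y. y \<in> space \<pi> \<Longrightarrow> 0 \<le> h y"
  shows "0 \<le> markov_op P h x"
  unfolding markov_op_def using assms kernel_at(3) by (intro integral_nonneg_AE AE_I2) auto

lemma markov_op_diff_const:
  assumes "x \<in> space \<pi>" "h \<in> bounded_measurable \<pi>"
  shows "markov_op P (\<lambda>y. h y - c) x = markov_op P h x - c"
proof -
  interpret Px: prob_space "P x" by (rule kernel_at assms)+
  show ?thesis using integrable_kernel[OF assms] by (simp add: markov_op_def Px.prob_space)
qed

lemma nn_integral_markov_op:
  assumes h: "h \<in> bounded_measurable \<pi>" and h0: "\<And>x. x \<in> space \<pi> \<Longrightarrow> 0 \<le> h x"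
    and x: "x \<in> space \<pi>"
  shows "(\<integral>\<^sup>+y. ennreal (h y) \<partial>P x) = ennreal (markov_op P h x)"
  unfolding markov_op_def using integrable_kernel[OF x h] h0 kernel_at(3)[OF x]
  by (intro nn_integral_eq_integral) auto

text \<open>Adding a bound \<open>K\<close> makes the function nonnegative, so invariance can be
  used for extended nonnegative integrals; \<open>K\<close> then cancels on both sides.\<close>

lemma integral_markov_op:
  assumes h: "h \<in> bounded_measurable \<pi>"
  shows "(\<integral>x. markov_op P h x \<partial>\<pi>) = (\<integral>x. h x \<partial>\<pi>)"
proof -
  obtain K where K: "0 \<le> K" "\<And>x. x \<in> space \<pi> \<Longrightarrow> \<bar>h x\<bar> \<le> K"
    using h by (metis bounded_measurable_bound)
  define g where "g = (\<lambda>x. h x - (- K))"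
  have g: "g \<in> bounded_measurable \<pi>" unfolding g_def by (intro bounded_measurable_intros h)
  have g0: "0 \<le> g x" if "x \<in> space \<pi>" for x using K(2)[OF that] by (auto simp: g_def)
  note Pg = markov_op_bounded_measurable[OF g]
  have "ennreal (\<integral>x. markov_op P g x \<partial>\<pi>) = (\<integral>\<^sup>+x. ennreal (markov_op P g x) \<partial>\<pi>)"
    using integrable_bounded_measurable[OF Pg] markov_op_mono_nonneg g0
    by (intro nn_integral_eq_integral[symmetric]) auto
  also have "\<dots> = (\<integral>\<^sup>+x. \<integral>\<^sup>+y. ennreal (g y) \<partial>P x \<partial>\<pi>)"
    using nn_integral_markov_op[OF g g0] by (intro nn_integral_cong) simp
  also have "\<dots> = (\<integral>\<^sup>+x. ennreal (g x) \<partial>\<pi>)"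
    using bounded_measurableD[OF g] by (intro nn_integral_kernel) measurable
  also have "\<dots> = ennreal (\<integral>x. g x \<partial>\<pi>)"
    using integrable_bounded_measurable[OF g] g0 by (intro nn_integral_eq_integral) auto
  finally have "(\<integral>x. markov_op P g x \<partial>\<pi>) = (\<integral>x. g x \<partial>\<pi>)"
    using markov_op_mono_nonneg g0 by (subst (asm) ennreal_inj) (auto intro!: integral_nonneg_AE AE_I2)
  moreover have "(\<integral>x. markov_op P g x \<partial>\<pi>) = (\<integral>x. markov_op P h x + K \<partial>\<pi>)"
    unfolding g_def by (intro Bochner_Integration.integral_cong) (simp_all add: markov_op_diff_const h del: diff_minus_eq_add)
  ultimately show ?thesis
    using integrable_bounded_measurable[OF h] integrable_bounded_measurable[OF markov_op_bounded_measurable[OF h]]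
    by (simp add: g_def prob_space)
qed

text \<open>Jensen's inequality under each \<open>P x\<close>, followed by invariance. The
  comparison runs through extended nonnegative integrals; if the square of
  \<open>markov_op P h\<close> is not integrable, its Bochner integral is 0 and the first step is
  trivial.\<close>

lemma L2_norm_markov_op_le:
  assumes h: "h \<in> L2_fun \<pi>"
  shows "L2_norm \<pi> (markov_op P h) \<le> L2_norm \<pi> h"
proof -
  have [measurable]: "h \<in> borel_measurable \<pi>" and i: "integrable \<pi> (\<lambda>x. (h x)\<^sup>2)"
    using h by (auto simp: L2_fun_def)
  have "ennreal (\<integral>x. (markov_op P h x)\<^sup>2 \<partial>\<pi>) \<le> (\<integral>\<^sup>+x. ennreal ((markov_op P h x)\<^sup>2) \<partial>\<pi>)"
  proof (cases "integrable \<pi> (\<lambda>x. (markov_op P h x)\<^sup>2)")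
    case True
    then show ?thesis by (subst nn_integral_eq_integral) auto
  qed (simp add: not_integrable_integral_eq)
  also have "\<dots> \<le> (\<integral>\<^sup>+x. \<integral>\<^sup>+y. ennreal ((h y)\<^sup>2) \<partial>P x \<partial>\<pi>)"
    unfolding markov_op_def
    by (intro nn_integral_mono prob_space.power2_integral_le_nn_integral kernel_at)
  also have "\<dots> = (\<integral>\<^sup>+x. ennreal ((h x)\<^sup>2) \<partial>\<pi>)" by (rule nn_integral_kernel) measurable
  also have "\<dots> = ennreal (\<integral>x. (h x)\<^sup>2 \<partial>\<pi>)" using i by (intro nn_integral_eq_integral) auto
  finally show ?thesis by (simp add: L2_norm_def)
qed

section \<open>The spectral gap on mean-zero functions and its bilinear form\<close>

lemma bdd_above_spectral:
  "bdd_above (insert 0 {L2_norm \<pi> (markov_op P h) |h.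
      h \<in> L2_fun \<pi> \<and> L2_norm \<pi> h = 1 \<and> (\<integral>x. h x \<partial>\<pi>) = 0})"
  by (rule bdd_aboveI[of _ 1]) (use L2_norm_markov_op_le in force)

lemma spectral_lambda_nonneg: "0 \<le> spectral_lambda \<pi> P"
  unfolding spectral_lambda_def by (rule cSup_upper[OF _ bdd_above_spectral]) simp

text \<open>Scaling to a unit vector brings \<open>h\<close> into the set whose supremum is taken. A
  function of norm 0 cannot be scaled, but contraction sends it to norm 0.\<close>

lemma L2_norm_markov_op_mean_zero:
  assumes h: "h \<in> L2_fun \<pi>" and h0: "(\<integral>x. h x \<partial>\<pi>) = 0"
  shows "L2_norm \<pi> (markov_op P h) \<le> spectral_lambda \<pi> P * L2_norm \<pi> h"
proof (cases "L2_norm \<pi> h = 0")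
  case True
  then show ?thesis using L2_norm_markov_op_le[OF h] by simp
next
  case False
  define c where "c = 1 / L2_norm \<pi> h"
  have c: "0 < c" "c * L2_norm \<pi> h = 1" using False by (auto simp: c_def order_less_le)
  define g where "g = (\<lambda>x. c * h x)"
  have "g \<in> L2_fun \<pi>" using h by (auto simp: L2_fun_def g_def power_mult_distrib)
  moreover have "L2_norm \<pi> g = 1" using c by (simp add: g_def L2_norm_cmult)
  moreover have "(\<integral>x. g x \<partial>\<pi>) = 0" using h0 by (simp add: g_def)
  ultimately have "L2_norm \<pi> (markov_op P g) \<le> spectral_lambda \<pi> P"
    unfolding spectral_lambda_def by (intro cSup_upper[OF _ bdd_above_spectral]) blast
  moreover have "markov_op P g = (\<lambda>x. c * markov_op P h x)"
    by (auto simp: markov_op_def g_def)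
  ultimately have "c * L2_norm \<pi> (markov_op P h) \<le> spectral_lambda \<pi> P * (c * L2_norm \<pi> h)"
    using c by (simp add: L2_norm_cmult)
  then show ?thesis using c(1) by (simp add: mult.left_commute)
qed

lemma bounded_measurable_L2: "h \<in> bounded_measurable \<pi> \<Longrightarrow> h \<in> L2_fun \<pi>"
  using integrable_bounded_measurable[OF bounded_measurable_power2]
  by (auto simp: L2_fun_def dest: bounded_measurableD)

text \<open>Split \<open>u\<close> and \<open>v\<close> into means and mean-zero parts.
  \<open>P\<close> preserves constants and \<pi>-integrals, so the cross terms vanish, and the gap
  bounds the mean-zero part by \<open>l\<close> times the product of norms. Since
  \<open>Q u = mu\<^sup>2 + l * (L2_norm \<pi> u0)\<^sup>2\<close>, and likewise for
  \<open>v\<close>, Cauchy-Schwarz in the plane concludes.\<close>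

lemma markov_op_form_le:
  assumes u: "u \<in> bounded_measurable \<pi>" and v: "v \<in> bounded_measurable \<pi>"
  defines "Q \<equiv> leon_perron_form \<pi> (spectral_lambda \<pi> P)"
  shows "\<bar>\<integral>x. u x * markov_op P v x \<partial>\<pi>\<bar> \<le> sqrt (Q u) * sqrt (Q v)"
proof -
  define l where "l = spectral_lambda \<pi> P"
  have l: "0 \<le> l" by (simp add: l_def spectral_lambda_nonneg)
  define mu mv where "mu = (\<integral>x. u x \<partial>\<pi>)" and "mv = (\<integral>x. v x \<partial>\<pi>)"
  define u0 v0 where "u0 = (\<lambda>x. u x - mu)" and "v0 = (\<lambda>x. v x - mv)"
  have u0: "u0 \<in> bounded_measurable \<pi>" and v0: "v0 \<in> bounded_measurable \<pi>"
    unfolding u0_def v0_def by (intro bounded_measurable_intros u v)+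
  note bm = bounded_measurable_intros bounded_measurable_power2 markov_op_bounded_measurable u v u0 v0
  have int [simp]: "g \<in> bounded_measurable \<pi> \<Longrightarrow> integrable \<pi> g" for g
    by (rule integrable_bounded_measurable)
  have [simp]: "integrable \<pi> u" "integrable \<pi> v" "integrable \<pi> (\<lambda>x. (u x)\<^sup>2)" "integrable \<pi> (\<lambda>x. (v x)\<^sup>2)"
    "integrable \<pi> (markov_op P v0)" "integrable \<pi> (\<lambda>x. u0 x * markov_op P v0 x)"
    by (intro int bm)+
  have m0: "(\<integral>x. u0 x \<partial>\<pi>) = 0" "(\<integral>x. v0 x \<partial>\<pi>) = 0"
    by (simp_all add: u0_def v0_def mu_def mv_def prob_space)
  have Q: "Q u = mu\<^sup>2 + l * (L2_norm \<pi> u0)\<^sup>2" "Q v = mv\<^sup>2 + l * (L2_norm \<pi> v0)\<^sup>2"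
  proof -
    have var: "(L2_norm \<pi> (\<lambda>x. h x - (\<integral>x. h x \<partial>\<pi>)))\<^sup>2 = (\<integral>x. (h x)\<^sup>2 \<partial>\<pi>) - (\<integral>x. h x \<partial>\<pi>)\<^sup>2"
      if "h \<in> bounded_measurable \<pi>" for h
      unfolding L2_norm_power2 using that
      by (intro variance_eq) (auto intro!: int bounded_measurable_power2)
    show "Q u = mu\<^sup>2 + l * (L2_norm \<pi> u0)\<^sup>2" "Q v = mv\<^sup>2 + l * (L2_norm \<pi> v0)\<^sup>2"
      unfolding Q_def leon_perron_form_def u0_def v0_def mu_def mv_def l_def var[OF u] var[OF v]
      by (simp_all add: algebra_simps)
  qed
  have "(\<integral>x. u x * markov_op P v x \<partial>\<pi>)
      = (\<integral>x. u0 x * markov_op P v0 x + mu * markov_op P v0 x + mv * u x \<partial>\<pi>)"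
  proof (rule Bochner_Integration.integral_cong[OF refl])
    fix x assume "x \<in> space \<pi>"
    then have "markov_op P v x = markov_op P v0 x + mv"
      unfolding v0_def by (simp add: markov_op_diff_const v)
    then show "u x * markov_op P v x = u0 x * markov_op P v0 x + mu * markov_op P v0 x + mv * u x"
      by (simp add: u0_def algebra_simps)
  qed
  also have "\<dots> = (\<integral>x. u0 x * markov_op P v0 x \<partial>\<pi>) + mu * mv"
    using m0 integral_markov_op[OF v0] by (simp add: mu_def)
  finally have eq: "(\<integral>x. u x * markov_op P v x \<partial>\<pi>) = (\<integral>x. u0 x * markov_op P v0 x \<partial>\<pi>) + mu * mv" .
  have "\<bar>\<integral>x. u0 x * markov_op P v0 x \<partial>\<pi>\<bar> \<le> L2_norm \<pi> u0 * L2_norm \<pi> (markov_op P v0)"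
    by (intro L2_norm_Cauchy_Schwarz int bm)
  also have "\<dots> \<le> L2_norm \<pi> u0 * (l * L2_norm \<pi> v0)"
    unfolding l_def
    by (intro mult_left_mono L2_norm_markov_op_mean_zero bounded_measurable_L2 v0 m0 L2_norm_nonneg)
  finally have "\<bar>\<integral>x. u x * markov_op P v x \<partial>\<pi>\<bar> \<le> \<bar>mu\<bar> * \<bar>mv\<bar> + l * (L2_norm \<pi> u0 * L2_norm \<pi> v0)"
    unfolding eq abs_mult[symmetric] by (simp add: mult.left_commute)
  also have "\<dots> = \<bar>mu\<bar> * \<bar>mv\<bar> + (sqrt l * L2_norm \<pi> u0) * (sqrt l * L2_norm \<pi> v0)"
    using l by simp
  also have "\<dots> \<le> sqrt (\<bar>mu\<bar>\<^sup>2 + (sqrt l * L2_norm \<pi> u0)\<^sup>2) * sqrt (\<bar>mv\<bar>\<^sup>2 + (sqrt l * L2_norm \<pi> v0)\<^sup>2)"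
  proof -
    have "(p * r + q * s)\<^sup>2 \<le> (p\<^sup>2 + q\<^sup>2) * (r\<^sup>2 + s\<^sup>2)" for p q r s :: real
      using zero_le_power2[of "p * s - q * r"] by (simp add: power2_eq_square algebra_simps)
    then show ?thesis unfolding real_sqrt_mult[symmetric] by (rule real_le_rsqrt)
  qed
  also have "\<dots> = sqrt (Q u) * sqrt (Q v)"
    using l by (simp add: Q power_mult_distrib)
  finally show ?thesis .
qed

text \<open>If \<open>k\<close> is the function on the left, its squared norm is the inner product
  of \<open>u = exp (f / 2) * k\<close> with \<open>P v\<close>, where
  \<open>v = exp (g / 2) * h\<close>. The form bound and the tilting bound for \<open>u\<close> and
  \<open>v\<close> then leave one factor \<open>L2_norm \<pi> k\<close> to divide by.\<close>

lemma L2_norm_tilted_markov_op_le: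
  assumes gap: "spectral_lambda \<pi> P < 1"
    and f: "f \<in> borel_measurable \<pi>" "\<And>x. x \<in> space \<pi> \<Longrightarrow> f x \<in> {a..b}" "(\<integral>x. f x \<partial>\<pi>) = 0"
    and g: "g \<in> borel_measurable \<pi>" "\<And>x. x \<in> space \<pi> \<Longrightarrow> g x \<in> {c..d}" "(\<integral>x. g x \<partial>\<pi>) = 0"
    and h: "h \<in> bounded_measurable \<pi>"
  shows "L2_norm \<pi> (\<lambda>x. exp (f x / 2) * markov_op P (\<lambda>y. exp (g y / 2) * h y) x)
     \<le> exp (gap_alpha (spectral_lambda \<pi> P) * ((b - a)\<^sup>2 + (d - c)\<^sup>2) / 16) * L2_norm \<pi> h"
proof -
  define l where "l = spectral_lambda \<pi> P"
  define A C where "A = exp (gap_alpha l * (b - a)\<^sup>2 / 16)" and "C = exp (gap_alpha l * (d - c)\<^sup>2 / 16)"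
  have AC: "exp (gap_alpha l * (b - a)\<^sup>2 / 8) = A\<^sup>2" "exp (gap_alpha l * (d - c)\<^sup>2 / 8) = C\<^sup>2"
    by (simp_all add: A_def C_def power2_eq_square flip: exp_add)
  have fb: "f \<in> bounded_measurable \<pi>"
    using f(1,2) by (rule bounded_measurable_interval)
  have gb: "g \<in> bounded_measurable \<pi>"
    using g(1,2) by (rule bounded_measurable_interval)
  define v where "v = (\<lambda>y. exp (g y / 2) * h y)"
  have v: "v \<in> bounded_measurable \<pi>" unfolding v_def by (intro bounded_measurable_mult bounded_measurable_exp_half gb h)
  define k where "k = (\<lambda>x. exp (f x / 2) * markov_op P v x)"
  have k: "k \<in> bounded_measurable \<pi>"
    unfolding k_def by (intro bounded_measurable_mult bounded_measurable_exp_half fb markov_op_bounded_measurable v)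
  define u where "u = (\<lambda>x. exp (f x / 2) * k x)"
  have u: "u \<in> bounded_measurable \<pi>" unfolding u_def by (intro bounded_measurable_mult bounded_measurable_exp_half fb k)
  \<comment> \<open>The weight \<open>exp (- f x)\<close> from \<open>leon_perron_form_tilt\<close>
    cancels the squared half tilt, leaving the untilted norm.\<close>
  have e2: "exp (- t) * (s * (exp (t / 2))\<^sup>2) = s" for s t :: real
    by (simp add: power2_eq_square exp_minus flip: exp_add)
  have "leon_perron_form \<pi> l u \<le> A\<^sup>2 * (\<integral>x. (u x)\<^sup>2 * exp (- f x) \<partial>\<pi>)"
    unfolding AC[symmetric] using gap spectral_lambda_nonneg f
    by (intro leon_perron_form_tilt u) (auto simp: l_def)
  also have "(\<integral>x. (u x)\<^sup>2 * exp (- f x) \<partial>\<pi>) = (L2_norm \<pi> k)\<^sup>2"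
    unfolding L2_norm_power2 u_def by (simp add: power_mult_distrib mult_ac e2)
  finally have Qu: "leon_perron_form \<pi> l u \<le> (A * L2_norm \<pi> k)\<^sup>2" by (simp add: power_mult_distrib)
  have "leon_perron_form \<pi> l v \<le> C\<^sup>2 * (\<integral>x. (v x)\<^sup>2 * exp (- g x) \<partial>\<pi>)"
    unfolding AC[symmetric] using gap spectral_lambda_nonneg g
    by (intro leon_perron_form_tilt v) (auto simp: l_def)
  also have "(\<integral>x. (v x)\<^sup>2 * exp (- g x) \<partial>\<pi>) = (L2_norm \<pi> h)\<^sup>2"
    unfolding L2_norm_power2 v_def by (simp add: power_mult_distrib mult_ac e2)
  finally have Qv: "leon_perron_form \<pi> l v \<le> (C * L2_norm \<pi> h)\<^sup>2" by (simp add: power_mult_distrib)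
  have "(L2_norm \<pi> k)\<^sup>2 = (\<integral>x. u x * markov_op P v x \<partial>\<pi>)"
    unfolding L2_norm_power2 u_def
    by (intro Bochner_Integration.integral_cong) (auto simp: k_def power2_eq_square algebra_simps)
  also have "\<dots> \<le> sqrt (leon_perron_form \<pi> l u) * sqrt (leon_perron_form \<pi> l v)"
    using markov_op_form_le[OF u v] unfolding l_def by linarith
  also have "\<dots> \<le> (A * L2_norm \<pi> k) * (C * L2_norm \<pi> h)"
  proof -
    have "0 \<le> leon_perron_form \<pi> l v"
      using gap spectral_lambda_nonneg by (simp add: leon_perron_form_def l_def)
    then show ?thesis
      by (intro mult_mono real_le_lsqrt Qu Qv) (auto simp: A_def C_def)
  qed
  finally have "L2_norm \<pi> k * L2_norm \<pi> k \<le> L2_norm \<pi> k * (A * C * L2_norm \<pi> h)"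
    by (simp add: power2_eq_square algebra_simps)
  then have "L2_norm \<pi> k \<le> A * C * L2_norm \<pi> h"
    using L2_norm_nonneg[of \<pi> k] L2_norm_nonneg[of \<pi> h]
    by (cases "L2_norm \<pi> k = 0") (auto simp: A_def C_def mult_le_cancel_left)
  moreover have "A * C = exp (gap_alpha l * ((b - a)\<^sup>2 + (d - c)\<^sup>2) / 16)"
    by (simp add: A_def C_def add_divide_distrib distrib_left flip: exp_add)
  ultimately show ?thesis by (simp add: k_def v_def l_def)
qed

end

section \<open>Stationary Markov chains\<close>

text \<open>Hoeffding's lemma is the tilting bound at \<open>l = 0\<close> and
  \<open>h = exp f\<close>: the form is then \<open>E\<^sup>2\<close>, the right-hand integral is
  \<open>E\<close>, and \<open>gap_alpha 0 = 1\<close>.\<close>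

lemma (in prob_space) integral_exp_le_Hoeffding:
  fixes f :: "'a \<Rightarrow> real"
  assumes f: "f \<in> borel_measurable M" "\<And>x. x \<in> space M \<Longrightarrow> f x \<in> {a..b}" "(\<integral>x. f x \<partial>M) = 0"
  shows "(\<integral>x. exp (f x) \<partial>M) \<le> exp ((b - a)\<^sup>2 / 8)"
proof -
  have fb: "f \<in> bounded_measurable M"
    using f(1,2) by (rule bounded_measurable_interval)
  define E where "E = (\<integral>x. exp (f x) \<partial>M)"
  have "leon_perron_form M 0 (\<lambda>x. exp (f x))
      \<le> exp (gap_alpha 0 * (b - a)\<^sup>2 / 8) * (\<integral>x. (exp (f x))\<^sup>2 * exp (- f x) \<partial>M)"
    using f fb by (intro leon_perron_form_tilt bounded_measurable_exp) auto
  also have "(\<integral>x. (exp (f x))\<^sup>2 * exp (- f x) \<partial>M) = E"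
    by (simp add: E_def power2_eq_square flip: exp_add)
  finally have *: "E * E \<le> E * exp ((b - a)\<^sup>2 / 8)"
    by (simp add: leon_perron_form_def gap_alpha_def E_def[symmetric] power2_eq_square mult.commute)
  have "0 \<le> E" by (simp add: E_def)
  then have "E \<le> exp ((b - a)\<^sup>2 / 8)"
    using * by (cases "E = 0") (auto simp: mult_le_cancel_left)
  then show ?thesis by (simp add: E_def)
qed

section \<open>Law and Markov property of the chain\<close>

locale stationary_markov_chain =
  fixes M :: "'w measure" and S \<pi> :: "'a measure"
    and P :: "nat \<Rightarrow> 'a \<Rightarrow> 'a measure" and X :: "nat \<Rightarrow> 'w \<Rightarrow> 'a"
  assumes prob_pi: "prob_space \<pi>" and sets_pi: "sets \<pi> = sets S"
    and chain: "markov_chain M S P X"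
    and invariant_kernels: "\<And>i. i \<ge> 1 \<Longrightarrow> invariant_kernel \<pi> (P i)"
    and initial: "distr M S (X 1) = \<pi>"
begin

lemma prob_space_M: "prob_space M"
  using chain by (simp add: markov_chain_def)

lemma space_pi: "space \<pi> = space S"
  using sets_pi by (rule sets_eq_imp_space_eq)

lemma X_measurable: "i \<ge> 1 \<Longrightarrow> X i \<in> M \<rightarrow>\<^sub>M \<pi>"
  using chain measurable_cong_sets[OF refl sets_pi] by (auto simp: markov_chain_def)

lemma kernel_prob_algebra: "i \<ge> 1 \<Longrightarrow> P i \<in> \<pi> \<rightarrow>\<^sub>M prob_algebra \<pi>"
proof -
  assume "i \<ge> 1"
  then have "P i \<in> S \<rightarrow>\<^sub>M prob_algebra S"
    using chain by (auto simp: markov_chain_def transition_kernel_def)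
  moreover have "prob_algebra \<pi> = prob_algebra S"
    using sets_pi subprob_algebra_cong[OF sets_pi] by (simp add: prob_algebra_def)
  ultimately show ?thesis by (simp add: measurable_cong_sets[OF sets_pi refl])
qed

lemma invariant_markov_kernel: "i \<ge> 1 \<Longrightarrow> invariant_markov_kernel \<pi> (P i)"
  by (simp add: invariant_markov_kernel_def invariant_markov_kernel_axioms_def
      prob_pi kernel_prob_algebra invariant_kernels)

lemma subalgebra_past: "subalgebra M (past_sigma M S X i)"
proof -
  have "(\<Union>j\<in>{1..i}. {X j -` A \<inter> space M |A. A \<in> sets S}) \<subseteq> sets M"
    using X_measurable sets_pi by (auto simp: measurable_sets)
  then show ?thesis
    unfolding subalgebra_def past_sigma_def
    by (subst sets_measure_of) (auto dest: sets.sets_into_space intro!: sets.sigma_sets_subset simp: space_measure_of_conv)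
qed

lemma X_past_measurable:
  assumes "j \<in> {1..i}"
  shows "X j \<in> past_sigma M S X i \<rightarrow>\<^sub>M \<pi>"
proof (rule measurableI)
  fix \<omega> assume "\<omega> \<in> space (past_sigma M S X i)"
  then show "X j \<omega> \<in> space \<pi>"
    using measurable_space[OF X_measurable, of j] assms by (simp add: past_sigma_def space_measure_of_conv)
next
  fix A assume A: "A \<in> sets \<pi>"
  have sub: "(\<Union>j\<in>{1..i}. {X j -` A \<inter> space M |A. A \<in> sets S}) \<subseteq> Pow (space M)" by auto
  have "X j -` A \<inter> space M \<in> sigma_sets (space M) (\<Union>j\<in>{1..i}. {X j -` A \<inter> space M |A. A \<in> sets S})"
    using assms A unfolding sets_pi by (intro sigma_sets.Basic UN_I[OF assms]) blast
  then show "X j -` A \<inter> space (past_sigma M S X i) \<in> sets (past_sigma M S X i)"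
    unfolding past_sigma_def sets_measure_of[OF sub] space_measure_of[OF sub] .
qed

text \<open>The Markov property is given for events \<open>X (Suc i) \<in> B\<close> only. Taking
  \<open>Y\<close> as a density turns it into an equation between the law of
  \<open>X (Suc i)\<close> and the law of \<open>X i\<close> followed by \<open>P i\<close>;
  integrating \<open>h\<close> against both laws gives the claim.\<close>

lemma markov_step_nn_integral:
  assumes i: "i \<ge> 1"
    and Y: "Y \<in> borel_measurable (past_sigma M S X i)" "\<And>\<omega>. 0 \<le> Y \<omega>" "\<And>\<omega>. \<omega> \<in> space M \<Longrightarrow> Y \<omega> \<le> K"
    and h: "h \<in> borel_measurable \<pi>"
  shows "(\<integral>\<^sup>+\<omega>. ennreal (Y \<omega>) * h (X (Suc i) \<omega>) \<partial>M)
       = (\<integral>\<^sup>+\<omega>. ennreal (Y \<omega>) * (\<integral>\<^sup>+y. h y \<partial>P i (X i \<omega>)) \<partial>M)"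
proof -
  interpret prob_space M by (rule prob_space_M)
  interpret pi: invariant_markov_kernel \<pi> "P i" by (rule invariant_markov_kernel[OF i])
  interpret past: finite_measure_subalgebra M "past_sigma M S X i"
    by unfold_locales (rule subalgebra_past)
  note [measurable] = X_measurable[OF i] X_measurable[of "Suc i", simplified] pi.kernel_subprob h
  have Ym [measurable]: "Y \<in> borel_measurable M"
    by (rule measurable_from_subalg[OF subalgebra_past Y(1)])
  have kernel_nn: "g \<in> borel_measurable \<pi> \<Longrightarrow> (\<lambda>x. \<integral>\<^sup>+y. g y \<partial>P i x) \<in> borel_measurable \<pi>" for g :: "'a \<Rightarrow> ennreal"
    by (rule measurable_compose[OF pi.kernel_subprob nn_integral_measurable_subprob_algebra])
  define D where "D = density M (\<lambda>\<omega>. ennreal (Y \<omega>))"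
  have [measurable_cong]: "sets D = sets M" by (simp add: D_def)
  have neD: "space (distr D \<pi> (X i)) \<noteq> {}" using pi.not_empty by simp
  have Pd: "P i \<in> distr D \<pi> (X i) \<rightarrow>\<^sub>M subprob_algebra \<pi>" by measurable
  have "distr D \<pi> (X (Suc i)) = distr D \<pi> (X i) \<bind> P i"
  proof (rule measure_eqI)
    show "sets (distr D \<pi> (X (Suc i))) = sets (distr D \<pi> (X i) \<bind> P i)"
      using sets_bind_measurable[OF Pd neD] by simp
  next
    fix B assume "B \<in> sets (distr D \<pi> (X (Suc i)))"
    then have B [measurable]: "B \<in> sets \<pi>" by simp
    define I :: "'w \<Rightarrow> real" where "I = indicator (X (Suc i) -` B \<inter> space M)"
    have Im [measurable]: "I \<in> borel_measurable M" unfolding I_def by measurable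
    have int: "integrable M (\<lambda>\<omega>. Y \<omega> * I \<omega>)"
    proof (rule integrable_const_bound[where B = "\<bar>K\<bar>"])
      show "AE \<omega> in M. norm (Y \<omega> * I \<omega>) \<le> \<bar>K\<bar>"
        using Y(2,3) by (intro AE_I2) (auto simp: I_def abs_mult indicator_def intro: order_trans[OF _ abs_ge_self])
    qed measurable
    have "AE \<omega> in M. real_cond_exp M (past_sigma M S X i) I \<omega> = measure (P i (X i \<omega>)) B"
      using chain i B sets_pi unfolding markov_chain_def I_def by auto
    then have "(\<integral>\<^sup>+\<omega>. ennreal (Y \<omega> * measure (P i (X i \<omega>)) B) \<partial>M)
        = (\<integral>\<^sup>+\<omega>. ennreal (Y \<omega> * real_cond_exp M (past_sigma M S X i) I \<omega>) \<partial>M)"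
      by (intro nn_integral_cong_AE) auto
    also have "\<dots> = ennreal (\<integral>\<omega>. Y \<omega> * real_cond_exp M (past_sigma M S X i) I \<omega> \<partial>M)"
    proof (rule nn_integral_eq_integral)
      show "integrable M (\<lambda>\<omega>. Y \<omega> * real_cond_exp M (past_sigma M S X i) I \<omega>)"
        by (rule past.real_cond_exp_intg_fpos(1)[OF int Y(2,1) Im])
      have "AE \<omega> in M. 0 \<le> real_cond_exp M (past_sigma M S X i) I \<omega>"
        by (rule past.real_cond_exp_pos) (auto simp: I_def)
      then show "AE \<omega> in M. 0 \<le> Y \<omega> * real_cond_exp M (past_sigma M S X i) I \<omega>"
        using Y(2) by auto
    qed
    \<comment> \<open>\<open>Y\<close> is measurable for the past, so testing against it replaces
      the conditional probability by the indicator.\<close>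
    also have "\<dots> = ennreal (\<integral>\<omega>. Y \<omega> * I \<omega> \<partial>M)"
      by (subst past.real_cond_exp_intg_fpos(2)[OF int Y(2,1) Im]) simp
    also have "\<dots> = (\<integral>\<^sup>+\<omega>. ennreal (Y \<omega> * I \<omega>) \<partial>M)"
      using int Y(2) by (intro nn_integral_eq_integral[symmetric]) (auto simp: I_def)
    finally have eq: "(\<integral>\<^sup>+\<omega>. ennreal (Y \<omega> * measure (P i (X i \<omega>)) B) \<partial>M)
        = (\<integral>\<^sup>+\<omega>. ennreal (Y \<omega> * I \<omega>) \<partial>M)" .
    have "emeasure (distr D \<pi> (X (Suc i))) B = emeasure D (X (Suc i) -` B \<inter> space M)"
      by (subst emeasure_distr) (auto simp: D_def)
    also have "\<dots> = (\<integral>\<^sup>+\<omega>. ennreal (Y \<omega> * I \<omega>) \<partial>M)"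
      unfolding D_def by (subst emeasure_density)
        (auto simp: I_def ennreal_mult' ennreal_indicator Y(2) intro!: nn_integral_cong)
    also have "\<dots> = (\<integral>\<^sup>+\<omega>. ennreal (Y \<omega>) * emeasure (P i (X i \<omega>)) B \<partial>M)"
      unfolding eq[symmetric]
    proof (rule nn_integral_cong)
      fix \<omega> assume "\<omega> \<in> space M"
      then interpret Px: prob_space "P i (X i \<omega>)"
        using measurable_space[OF X_measurable[OF i]] by (intro pi.kernel_at) auto
      show "ennreal (Y \<omega> * measure (P i (X i \<omega>)) B) = ennreal (Y \<omega>) * emeasure (P i (X i \<omega>)) B"
        by (simp add: Px.emeasure_eq_measure ennreal_mult' Y(2))
    qed
    also have "\<dots> = (\<integral>\<^sup>+\<omega>. emeasure (P i (X i \<omega>)) B \<partial>D)"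
      unfolding D_def by (subst nn_integral_density) auto
    also have "\<dots> = (\<integral>\<^sup>+x. emeasure (P i x) B \<partial>distr D \<pi> (X i))"
      by (subst nn_integral_distr) auto
    also have "\<dots> = emeasure (distr D \<pi> (X i) \<bind> P i) B"
      by (rule emeasure_bind[OF neD Pd B, symmetric])
    finally show "emeasure (distr D \<pi> (X (Suc i))) B = emeasure (distr D \<pi> (X i) \<bind> P i) B" .
  qed
  then have "(\<integral>\<^sup>+x. h x \<partial>distr D \<pi> (X (Suc i))) = (\<integral>\<^sup>+x. \<integral>\<^sup>+y. h y \<partial>P i x \<partial>distr D \<pi> (X i))"
    using nn_integral_bind[OF h Pd] by simp
  then show ?thesis
    by (simp add: nn_integral_distr D_def nn_integral_density kernel_nn measurable_compose[OF _ kernel_nn])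
qed

text \<open>Invariance carries the initial law forward; the induction step is
  \<open>markov_step_nn_integral\<close> with \<open>Y = 1\<close> and an indicator for
  \<open>h\<close>.\<close>

lemma distr_X:
  assumes "i \<ge> 1"
  shows "distr M \<pi> (X i) = \<pi>"
  using assms
proof (induction i rule: dec_induct)
  case base
  have "distr M \<pi> (X 1) = distr M S (X 1)" by (rule distr_cong) (auto simp: sets_pi)
  then show ?case using initial by simp
next
  case (step i)
  interpret pi: invariant_markov_kernel \<pi> "P i" using step by (intro invariant_markov_kernel) simp
  note [measurable] = X_measurable[of "Suc i", simplified]
  show ?case
  proof (rule measure_eqI)
    fix B assume "B \<in> sets (distr M \<pi> (X (Suc i)))"
    then have B [measurable]: "B \<in> sets \<pi>" by simp
    have Xi: "X i \<in> M \<rightarrow>\<^sub>M \<pi>" using step by (intro X_measurable) simp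
    have kB: "(\<lambda>x. \<integral>\<^sup>+y. indicator B y \<partial>P i x) \<in> borel_measurable \<pi>"
      by (rule measurable_compose[OF pi.kernel_subprob nn_integral_measurable_subprob_algebra]) measurable
    have "emeasure (distr M \<pi> (X (Suc i))) B = (\<integral>\<^sup>+x. indicator B x \<partial>distr M \<pi> (X (Suc i)))"
      by simp
    also have "\<dots> = (\<integral>\<^sup>+\<omega>. indicator B (X (Suc i) \<omega>) \<partial>M)"
      by (rule nn_integral_distr) measurable
    also have "\<dots> = (\<integral>\<^sup>+\<omega>. (\<integral>\<^sup>+y. indicator B y \<partial>P i (X i \<omega>)) \<partial>M)"
      using markov_step_nn_integral[of i "\<lambda>_. 1" 1 "indicator B"] step by simp
    also have "\<dots> = (\<integral>\<^sup>+x. \<integral>\<^sup>+y. indicator B y \<partial>P i x \<partial>distr M \<pi> (X i))"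
      using kB by (subst nn_integral_distr[OF Xi]) auto
    also have "\<dots> = (\<integral>\<^sup>+x. indicator B x \<partial>\<pi>)"
      unfolding step.IH by (rule pi.nn_integral_kernel) measurable
    finally show "emeasure (distr M \<pi> (X (Suc i))) B = emeasure \<pi> B" by simp
  qed simp
qed

lemma integral_X:
  fixes h :: "'a \<Rightarrow> real"
  assumes "i \<ge> 1" "h \<in> borel_measurable \<pi>"
  shows "(\<integral>\<omega>. h (X i \<omega>) \<partial>M) = (\<integral>x. h x \<partial>\<pi>)"
  using integral_distr[OF X_measurable[OF assms(1)] assms(2)] distr_X[OF assms(1)] by simp

lemma markov_step:
  assumes i: "i \<ge> 1"
    and Y: "Y \<in> bounded_measurable (past_sigma M S X i)" "\<And>\<omega>. 0 \<le> Y \<omega>"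
    and h: "h \<in> bounded_measurable \<pi>" "\<And>x. x \<in> space \<pi> \<Longrightarrow> 0 \<le> h x"
  shows "(\<integral>\<omega>. Y \<omega> * h (X (Suc i) \<omega>) \<partial>M) = (\<integral>\<omega>. Y \<omega> * markov_op (P i) h (X i \<omega>) \<partial>M)"
proof -
  interpret prob_space M by (rule prob_space_M)
  interpret pi: invariant_markov_kernel \<pi> "P i" by (rule invariant_markov_kernel[OF i])
  have sp: "space (past_sigma M S X i) = space M" by (simp add: past_sigma_def space_measure_of_conv)
  obtain K where K: "\<And>\<omega>. \<omega> \<in> space M \<Longrightarrow> \<bar>Y \<omega>\<bar> \<le> K"
    using Y(1) sp by (metis bounded_measurable_bound)
  have YM: "Y \<in> bounded_measurable M"
    using K measurable_from_subalg[OF subalgebra_past bounded_measurableD[OF Y(1)]]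
    by (intro bounded_measurableI)
  note Xi = X_measurable[OF i] and XS = X_measurable[of "Suc i", simplified]
  note Ph = pi.markov_op_bounded_measurable[OF h(1)]
  have sX: "X i \<omega> \<in> space \<pi>" "X (Suc i) \<omega> \<in> space \<pi>" if "\<omega> \<in> space M" for \<omega>
    using that measurable_space[OF Xi] measurable_space[OF XS] by auto
  have bm: "(\<lambda>\<omega>. Y \<omega> * h (X (Suc i) \<omega>)) \<in> bounded_measurable M"
    "(\<lambda>\<omega>. Y \<omega> * markov_op (P i) h (X i \<omega>)) \<in> bounded_measurable M"
    by (intro bounded_measurable_mult YM bounded_measurable_comp[OF h(1) XS] bounded_measurable_comp[OF Ph Xi])+
  have "ennreal (\<integral>\<omega>. Y \<omega> * h (X (Suc i) \<omega>) \<partial>M) = (\<integral>\<^sup>+\<omega>. ennreal (Y \<omega> * h (X (Suc i) \<omega>)) \<partial>M)"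
    using integrable_bounded_measurable[OF bm(1)] Y(2) h(2) sX
    by (intro nn_integral_eq_integral[symmetric]) auto
  also have "\<dots> = (\<integral>\<^sup>+\<omega>. ennreal (Y \<omega>) * ennreal (h (X (Suc i) \<omega>)) \<partial>M)"
    using Y(2) by (simp add: ennreal_mult')
  also have "\<dots> = (\<integral>\<^sup>+\<omega>. ennreal (Y \<omega>) * (\<integral>\<^sup>+y. ennreal (h y) \<partial>P i (X i \<omega>)) \<partial>M)"
    using K Y bounded_measurableD[OF h(1)]
    by (intro markov_step_nn_integral[OF i]) (auto dest: bounded_measurableD abs_le_D1)
  also have "\<dots> = (\<integral>\<^sup>+\<omega>. ennreal (Y \<omega> * markov_op (P i) h (X i \<omega>)) \<partial>M)"
    using Y(2) sX by (intro nn_integral_cong) (simp add: ennreal_mult' pi.nn_integral_markov_op h)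
  also have "\<dots> = ennreal (\<integral>\<omega>. Y \<omega> * markov_op (P i) h (X i \<omega>) \<partial>M)"
    using integrable_bounded_measurable[OF bm(2)] Y(2) h(2) sX pi.markov_op_mono_nonneg
    by (intro nn_integral_eq_integral) auto
  finally show ?thesis
    using Y(2) h(2) sX pi.markov_op_mono_nonneg
    by (subst (asm) ennreal_inj) (auto intro!: integral_nonneg_AE AE_I2)
qed

end

section \<open>The moment generating function and the tail\<close>

lemma (in prob_space) sub_gaussian_tail:
  assumes s: "0 < s" and Z: "\<And>t. integrable M (\<lambda>\<omega>. exp (t * Z \<omega>))"
    "\<And>t. (\<integral>\<omega>. exp (t * Z \<omega>) \<partial>M) \<le> exp (s * t\<^sup>2 / 2)" and e: "0 < e"
  shows "measure M {\<omega> \<in> space M. e \<le> Z \<omega>} \<le> exp (- (e\<^sup>2 / (2 * s)))"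
proof -
  \<comment> \<open>Chernoff's bound at \<open>t = e / s\<close>, the minimiser of
    \<open>s * t\<^sup>2 / 2 - t * e\<close>.\<close>
  have "measure M {\<omega> \<in> space M. e \<le> Z \<omega>} \<le> exp (- (e / s) * e) * (\<integral>\<omega>\<in>space M. exp (e / s * Z \<omega>) \<partial>M)"
    using s e integrable_mult_indicator[OF sets.top Z(1)[of "e / s"]]
    by (intro Chernoff_ineq_ge) (auto simp: set_integrable_def)
  also have "\<dots> = exp (- (e / s) * e) * (\<integral>\<omega>. exp (e / s * Z \<omega>) \<partial>M)"
    by (subst set_integral_space[OF Z(1)]) simp
  also have "\<dots> \<le> exp (- (e / s) * e) * exp (s * (e / s)\<^sup>2 / 2)"
    by (intro mult_left_mono Z(2)) auto
  also have "\<dots> = exp (- (e\<^sup>2 / (2 * s)))"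
    using s by (simp flip: exp_add) (simp add: field_simps power2_eq_square)
  finally show ?thesis .
qed

lemma (in prob_space) sub_gaussian_two_sided_tail:
  assumes s: "0 < s" and Z: "\<And>t. integrable M (\<lambda>\<omega>. exp (t * Z \<omega>))"
    "\<And>t. (\<integral>\<omega>. exp (t * Z \<omega>) \<partial>M) \<le> exp (s * t\<^sup>2 / 2)" and e: "0 < e"
    and Zm [measurable]: "Z \<in> borel_measurable M"
  shows "measure M {\<omega> \<in> space M. e < \<bar>Z \<omega>\<bar>} \<le> 2 * exp (- (e\<^sup>2 / (2 * s)))"
proof -
  have "measure M {\<omega> \<in> space M. e \<le> Z \<omega>} \<le> exp (- (e\<^sup>2 / (2 * s)))"
    by (rule sub_gaussian_tail[OF s Z e])
  moreover have "measure M {\<omega> \<in> space M. e \<le> - Z \<omega>} \<le> exp (- (e\<^sup>2 / (2 * s)))"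
    using Z[of "- _"] by (intro sub_gaussian_tail[OF s _ _ e]) auto
  moreover have "measure M {\<omega> \<in> space M. e < \<bar>Z \<omega>\<bar>}
      \<le> measure M ({\<omega> \<in> space M. e \<le> Z \<omega>} \<union> {\<omega> \<in> space M. e \<le> - Z \<omega>})"
    by (intro finite_measure_mono) auto
  moreover have "\<dots> \<le> measure M {\<omega> \<in> space M. e \<le> Z \<omega>} + measure M {\<omega> \<in> space M. e \<le> - Z \<omega>}"
    by (intro measure_Un_le) auto
  ultimately show ?thesis by linarith
qed

text \<open>Every inner \<open>c i\<close> is halved between its two adjacent transitions. Replacing
  each coefficient by \<open>gap_alpha L\<close> rejoins the halves, and the two end terms use
  \<open>gap_alpha L \<ge> 1\<close>.\<close>

lemma variance_proxy_le:
  fixes c l :: "nat \<Rightarrow> real" and L :: real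
  assumes "1 \<le> n" "\<And>i. i \<in> {1..n} \<Longrightarrow> 0 \<le> l i \<and> l i \<le> L" "L < 1" "\<And>i. 0 \<le> c i"
  shows "c 1 / 8 + (\<Sum>i=2..n. gap_alpha (l (i - 1)) * ((c (i - 1) + c i) / 8)) + c n / 8
       \<le> gap_alpha L * (\<Sum>i=1..n. c i / 4)"
proof -
  have L: "1 \<le> gap_alpha L" using assms by (intro gap_alpha_ge_1) force+
  \<comment> \<open>Strengthened for the induction: the last term carries the factor
    \<open>gap_alpha L\<close>, which pays for the \<open>c n\<close> half of the next
    transition.\<close>
  have "c 1 / 8 + (\<Sum>i=2..n. gap_alpha (l (i - 1)) * ((c (i - 1) + c i) / 8)) + gap_alpha L * c n / 8
       \<le> gap_alpha L * (\<Sum>i=1..n. c i / 4)"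
    using assms(1,2)
  proof (induction n rule: dec_induct)
    case base
    show ?case using mult_right_mono[OF L assms(4)[of 1]] by (simp add: field_simps)
  next
    case (step n)
    have "gap_alpha (l n) * ((c n + c (Suc n)) / 8) \<le> gap_alpha L * ((c n + c (Suc n)) / 8)"
      using step assms by (intro mult_right_mono gap_alpha_mono add_nonneg_nonneg divide_nonneg_nonneg) auto
    moreover have "{2..Suc n} = insert (Suc n) {2..n}" using step by auto
    ultimately show ?case using step by (simp add: field_simps)
  qed
  moreover have "c n \<le> gap_alpha L * c n" using L assms(4)[of n] by (simp add: mult_le_cancel_right1)
  ultimately show ?thesis by simp
qed

section \<open>Moment generating function by induction along the chain\<close>

context stationary_markov_chain
begin

text \<open>Induction over time with \<open>h\<close> arbitrary, the last tilt entering with half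
  its exponent. Each step moves \<open>exp (g / 2) * h\<close> through one kernel and costs the
  operator norm bound of that transition. Nonnegativity of \<open>h\<close> is carried along for
  \<open>markov_step\<close>.\<close>

lemma tilted_expectation_le:
  fixes g :: "nat \<Rightarrow> 'a \<Rightarrow> real" and c d :: "nat \<Rightarrow> real"
  assumes gap: "\<And>i. i \<ge> 1 \<Longrightarrow> spectral_lambda \<pi> (P i) < 1"
    and g: "\<And>i. i \<in> {1..n} \<Longrightarrow> g i \<in> borel_measurable \<pi>"
      "\<And>i x. i \<in> {1..n} \<Longrightarrow> x \<in> space \<pi> \<Longrightarrow> g i x \<in> {c i..d i}"
      "\<And>i. i \<in> {1..n} \<Longrightarrow> (\<integral>x. g i x \<partial>\<pi>) = 0"
    and n: "1 \<le> n"
    and h: "h \<in> bounded_measurable \<pi>" "\<And>x. x \<in> space \<pi> \<Longrightarrow> 0 \<le> h x"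
  shows "(\<integral>\<omega>. exp (\<Sum>i=1..<n. g i (X i \<omega>)) * (exp (g n (X n \<omega>) / 2) * h (X n \<omega>)) \<partial>M)
    \<le> exp (((d 1 - c 1)\<^sup>2 + (\<Sum>i=2..n. gap_alpha (spectral_lambda \<pi> (P (i - 1)))
            * ((d (i - 1) - c (i - 1))\<^sup>2 + (d i - c i)\<^sup>2))) / 16) * L2_norm \<pi> h"
proof -
  interpret pi: prob_space \<pi> by (rule prob_pi)
  have gb: "g i \<in> bounded_measurable \<pi>" if "i \<in> {1..n}" for i
    using g(1,2)[OF that] by (rule bounded_measurable_interval)
  have exp_half: "(\<lambda>x. exp (g i x / 2)) \<in> bounded_measurable \<pi>" if "i \<in> {1..n}" for i
    using gb[OF that] by (rule bounded_measurable_exp_half)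

  have "(\<integral>\<omega>. exp (\<Sum>i=1..<m. g i (X i \<omega>)) * (exp (g m (X m \<omega>) / 2) * h (X m \<omega>)) \<partial>M)
    \<le> exp (((d 1 - c 1)\<^sup>2 + (\<Sum>i=2..m. gap_alpha (spectral_lambda \<pi> (P (i - 1)))
            * ((d (i - 1) - c (i - 1))\<^sup>2 + (d i - c i)\<^sup>2))) / 16) * L2_norm \<pi> h"
    if "1 \<le> m" "m \<le> n" "h \<in> bounded_measurable \<pi>" "\<And>x. x \<in> space \<pi> \<Longrightarrow> 0 \<le> h x" for m h
    using that
  proof (induction m arbitrary: h rule: dec_induct)
    case base
    define e where "e = (\<lambda>x. exp (g 1 x / 2))"
    have e: "e \<in> bounded_measurable \<pi>" using n by (simp add: e_def exp_half)
    note h = \<open>h \<in> bounded_measurable \<pi>\<close>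
    note bm = bounded_measurable_mult bounded_measurable_power2 e h
    have "(\<integral>\<omega>. exp (\<Sum>i=1..<1. g i (X i \<omega>)) * (exp (g 1 (X 1 \<omega>) / 2) * h (X 1 \<omega>)) \<partial>M)
        = (\<integral>\<omega>. e (X 1 \<omega>) * h (X 1 \<omega>) \<partial>M)" by (simp add: e_def)
    also have "\<dots> = (\<integral>x. e x * h x \<partial>\<pi>)"
      using bounded_measurableD[OF bounded_measurable_mult[OF e h]] by (intro integral_X) auto
    also have "\<dots> \<le> \<bar>\<integral>x. e x * h x \<partial>\<pi>\<bar>" by simp
    \<comment> \<open>The first half tilt faces no kernel, so its norm is bounded by Hoeffding's
      lemma; this is the end term for index 1.\<close>
    also have "\<dots> \<le> L2_norm \<pi> e * L2_norm \<pi> h"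
      by (intro L2_norm_Cauchy_Schwarz pi.integrable_bounded_measurable bm)
    also have "\<dots> \<le> exp ((d 1 - c 1)\<^sup>2 / 16) * L2_norm \<pi> h"
    proof (rule mult_right_mono)
      have "(L2_norm \<pi> e)\<^sup>2 = (\<integral>x. exp (g 1 x) \<partial>\<pi>)"
        unfolding L2_norm_power2 e_def by (simp add: power2_eq_square flip: exp_add)
      also have "\<dots> \<le> exp ((d 1 - c 1)\<^sup>2 / 8)"
        using n g by (intro pi.integral_exp_le_Hoeffding) auto
      also have "\<dots> = (exp ((d 1 - c 1)\<^sup>2 / 16))\<^sup>2"
        by (simp add: power2_eq_square flip: exp_add)
      finally show "L2_norm \<pi> e \<le> exp ((d 1 - c 1)\<^sup>2 / 16)" by (rule power2_le_imp_le) simp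
    qed simp
    finally show ?case by simp
  next
    case (step m)
    interpret Pm: invariant_markov_kernel \<pi> "P m" using step by (intro invariant_markov_kernel) simp
    have m: "m \<in> {1..n}" "Suc m \<in> {1..n}" using step by auto
    define v where "v = (\<lambda>x. exp (g (Suc m) x / 2) * h x)"
    have v: "v \<in> bounded_measurable \<pi>"
      unfolding v_def using m step by (intro bounded_measurable_mult exp_half) auto
    have v0: "0 \<le> v x" if "x \<in> space \<pi>" for x using step that by (simp add: v_def)
    \<comment> \<open>The tilt at time \<open>m\<close> is split evenly: one half goes into
      \<open>k\<close>, the other remains in front, so the expression has the same shape at time
      \<open>m\<close> with \<open>k\<close> in place of \<open>h\<close>.\<close>
    define k where "k = (\<lambda>x. exp (g m x / 2) * markov_op (P m) v x)"
    have k: "k \<in> bounded_measurable \<pi>"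
      unfolding k_def using m by (intro bounded_measurable_mult exp_half Pm.markov_op_bounded_measurable v)
    have k0: "0 \<le> k x" if "x \<in> space \<pi>" for x
      unfolding k_def using that v0 by (intro mult_nonneg_nonneg Pm.markov_op_mono_nonneg) auto
    define Y where "Y \<omega> = exp (\<Sum>i=1..m. g i (X i \<omega>))" for \<omega>
    have Y: "Y \<in> bounded_measurable (past_sigma M S X m)"
      unfolding Y_def[abs_def] using m
      by (intro bounded_measurable_exp bounded_measurable_sum bounded_measurable_comp[OF gb X_past_measurable]) auto
    have sum_m: "(\<Sum>i=1..m. g i (X i \<omega>)) = (\<Sum>i=1..<m. g i (X i \<omega>)) + g m (X m \<omega>)" for \<omega>
      using m by (simp add: sum.last_plus add.commute)
    have Y': "Y \<omega> = exp (\<Sum>i=1..<m. g i (X i \<omega>)) * (exp (g m (X m \<omega>) / 2) * exp (g m (X m \<omega>) / 2))" for \<omega>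
      unfolding Y_def sum_m by (simp flip: exp_add)
    have "{1..<Suc m} = {1..m}" by auto
    then have "(\<integral>\<omega>. exp (\<Sum>i=1..<Suc m. g i (X i \<omega>)) * (exp (g (Suc m) (X (Suc m) \<omega>) / 2) * h (X (Suc m) \<omega>)) \<partial>M)
        = (\<integral>\<omega>. Y \<omega> * v (X (Suc m) \<omega>) \<partial>M)" by (simp add: Y_def v_def)
    also have "\<dots> = (\<integral>\<omega>. Y \<omega> * markov_op (P m) v (X m \<omega>) \<partial>M)"
      using m by (intro markov_step Y v v0) (auto simp: Y_def)
    also have "\<dots> = (\<integral>\<omega>. exp (\<Sum>i=1..<m. g i (X i \<omega>)) * (exp (g m (X m \<omega>) / 2) * k (X m \<omega>)) \<partial>M)"
      by (simp add: Y' k_def mult_ac)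
    also have "\<dots> \<le> exp (((d 1 - c 1)\<^sup>2 + (\<Sum>i=2..m. gap_alpha (spectral_lambda \<pi> (P (i - 1)))
            * ((d (i - 1) - c (i - 1))\<^sup>2 + (d i - c i)\<^sup>2))) / 16) * L2_norm \<pi> k"
      using step.prems by (intro step.IH k k0) auto
    also have "\<dots> \<le> exp (((d 1 - c 1)\<^sup>2 + (\<Sum>i=2..m. gap_alpha (spectral_lambda \<pi> (P (i - 1)))
            * ((d (i - 1) - c (i - 1))\<^sup>2 + (d i - c i)\<^sup>2))) / 16)
          * (exp (gap_alpha (spectral_lambda \<pi> (P m)) * ((d m - c m)\<^sup>2 + (d (Suc m) - c (Suc m))\<^sup>2) / 16)
             * L2_norm \<pi> h)"
      unfolding k_def v_def using m step.prems
      by (intro mult_left_mono Pm.L2_norm_tilted_markov_op_le gap g) auto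
    also have "\<dots> = exp (((d 1 - c 1)\<^sup>2 + (\<Sum>i=2..Suc m. gap_alpha (spectral_lambda \<pi> (P (i - 1)))
            * ((d (i - 1) - c (i - 1))\<^sup>2 + (d i - c i)\<^sup>2))) / 16) * L2_norm \<pi> h"
    proof -
      have "{2..Suc m} = insert (Suc m) {2..m}" using m by auto
      then show ?thesis by (simp add: add_divide_distrib exp_add)
    qed
    finally show ?case .
  qed
  then show ?thesis using n h by blast
qed

text \<open>The choice \<open>h = exp (g n / 2)\<close> restores the missing half of the last tilt,
  and Hoeffding's lemma bounds its norm by the end term for index \<open>n\<close>.\<close>

lemma expectation_exp_sum_centered_le:
  fixes g :: "nat \<Rightarrow> 'a \<Rightarrow> real" and c d :: "nat \<Rightarrow> real"
  assumes gap: "\<And>i. i \<ge> 1 \<Longrightarrow> spectral_lambda \<pi> (P i) < 1"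
    and g: "\<And>i. i \<in> {1..n} \<Longrightarrow> g i \<in> borel_measurable \<pi>"
      "\<And>i x. i \<in> {1..n} \<Longrightarrow> x \<in> space \<pi> \<Longrightarrow> g i x \<in> {c i..d i}"
      "\<And>i. i \<in> {1..n} \<Longrightarrow> (\<integral>x. g i x \<partial>\<pi>) = 0"
    and n: "1 \<le> n"
  shows "(\<integral>\<omega>. exp (\<Sum>i=1..n. g i (X i \<omega>)) \<partial>M)
    \<le> exp (((d 1 - c 1)\<^sup>2 + (\<Sum>i=2..n. gap_alpha (spectral_lambda \<pi> (P (i - 1)))
            * ((d (i - 1) - c (i - 1))\<^sup>2 + (d i - c i)\<^sup>2)) + (d n - c n)\<^sup>2) / 16)"
proof -
  interpret pi: prob_space \<pi> by (rule prob_pi)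
  define e where "e = (\<lambda>x. exp (g n x / 2))"
  have gn: "g n \<in> bounded_measurable \<pi>"
    using g(1,2)[of n] n by (intro bounded_measurable_interval) auto
  have e: "e \<in> bounded_measurable \<pi>"
    unfolding e_def using gn by (rule bounded_measurable_exp_half)
  have sum_n: "(\<Sum>i=1..n. g i (X i \<omega>)) = (\<Sum>i=1..<n. g i (X i \<omega>)) + g n (X n \<omega>)" for \<omega>
    using n by (simp add: sum.last_plus add.commute)
  have "(L2_norm \<pi> e)\<^sup>2 = (\<integral>x. exp (g n x) \<partial>\<pi>)"
    unfolding L2_norm_power2 e_def by (simp add: power2_eq_square flip: exp_add)
  also have "\<dots> \<le> exp ((d n - c n)\<^sup>2 / 8)"
    using n g by (intro pi.integral_exp_le_Hoeffding) auto
  also have "\<dots> = (exp ((d n - c n)\<^sup>2 / 16))\<^sup>2"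
    by (simp add: power2_eq_square flip: exp_add)
  finally have norm_e: "L2_norm \<pi> e \<le> exp ((d n - c n)\<^sup>2 / 16)" by (rule power2_le_imp_le) simp
  have "(\<integral>\<omega>. exp (\<Sum>i=1..n. g i (X i \<omega>)) \<partial>M)
      = (\<integral>\<omega>. exp (\<Sum>i=1..<n. g i (X i \<omega>)) * (exp (g n (X n \<omega>) / 2) * e (X n \<omega>)) \<partial>M)"
    unfolding sum_n e_def by (simp flip: exp_add)
  also have "\<dots> \<le> exp (((d 1 - c 1)\<^sup>2 + (\<Sum>i=2..n. gap_alpha (spectral_lambda \<pi> (P (i - 1)))
            * ((d (i - 1) - c (i - 1))\<^sup>2 + (d i - c i)\<^sup>2))) / 16) * L2_norm \<pi> e"
    by (intro tilted_expectation_le gap g n e) (auto simp: e_def)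
  also have "\<dots> \<le> exp (((d 1 - c 1)\<^sup>2 + (\<Sum>i=2..n. gap_alpha (spectral_lambda \<pi> (P (i - 1)))
            * ((d (i - 1) - c (i - 1))\<^sup>2 + (d i - c i)\<^sup>2))) / 16) * exp ((d n - c n)\<^sup>2 / 16)"
    by (intro mult_left_mono norm_e) simp
  finally show ?thesis by (simp add: add_divide_distrib flip: exp_add)
qed

lemma expectation_exp_sum_le:
  fixes f :: "nat \<Rightarrow> 'a \<Rightarrow> real" and a b :: "nat \<Rightarrow> real"
  assumes gap: "\<And>i. i \<ge> 1 \<Longrightarrow> spectral_lambda \<pi> (P i) < 1"
    and f: "\<And>i. i \<in> {1..n} \<Longrightarrow> f i \<in> borel_measurable \<pi>"
      "\<And>i x. i \<in> {1..n} \<Longrightarrow> x \<in> space \<pi> \<Longrightarrow> f i x \<in> {a i..b i}"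
    and n: "1 \<le> n"
  defines "v \<equiv> (b 1 - a 1)\<^sup>2 / 8
      + (\<Sum>i=2..n. gap_alpha (spectral_lambda \<pi> (P (i - 1)))
            * (((b (i - 1) - a (i - 1))\<^sup>2 + (b i - a i)\<^sup>2) / 8)) + (b n - a n)\<^sup>2 / 8"
  shows "(\<integral>\<omega>. exp (t * (\<Sum>i=1..n. f i (X i \<omega>) - (\<integral>x. f i x \<partial>\<pi>))) \<partial>M) \<le> exp (v * t\<^sup>2 / 2)"
proof -
  interpret pi: prob_space \<pi> by (rule prob_pi)
  define \<mu> where "\<mu> i = (\<integral>x. f i x \<partial>\<pi>)" for i
  define g where "g i x = t * (f i x - \<mu> i)" for i x
  \<comment> \<open>The parameter \<open>t\<close> is absorbed into the functions. For negative
    \<open>t\<close> the endpoints change places, and squared lengths scale by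
    \<open>t\<^sup>2\<close> either way.\<close>
  define c d where "c i = t * ((if 0 \<le> t then a i else b i) - \<mu> i)"
    and "d i = t * ((if 0 \<le> t then b i else a i) - \<mu> i)" for i
  have dc: "(d i - c i)\<^sup>2 = t\<^sup>2 * (b i - a i)\<^sup>2" for i
    by (auto simp: c_def d_def power2_eq_square algebra_simps)
  have fi: "integrable \<pi> (f i)" if "i \<in> {1..n}" for i
    using f(1,2)[OF that] by (intro pi.integrable_bounded_measurable bounded_measurable_interval)
  have "(\<integral>\<omega>. exp (t * (\<Sum>i=1..n. f i (X i \<omega>) - \<mu> i)) \<partial>M) = (\<integral>\<omega>. exp (\<Sum>i=1..n. g i (X i \<omega>)) \<partial>M)"
    by (simp add: g_def sum_distrib_left)
  also have "\<dots> \<le> exp (((d 1 - c 1)\<^sup>2 + (\<Sum>i=2..n. gap_alpha (spectral_lambda \<pi> (P (i - 1)))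
            * ((d (i - 1) - c (i - 1))\<^sup>2 + (d i - c i)\<^sup>2)) + (d n - c n)\<^sup>2) / 16)"
  proof (intro expectation_exp_sum_centered_le gap n)
    fix i assume i: "i \<in> {1..n}"
    show "g i \<in> borel_measurable \<pi>" using f(1)[OF i] by (simp add: g_def[abs_def])
    show "(\<integral>x. g i x \<partial>\<pi>) = 0" using fi[OF i] by (simp add: g_def \<mu>_def pi.prob_space)
    fix x assume x: "x \<in> space \<pi>"
    show "g i x \<in> {c i..d i}"
      using f(2)[OF i x] by (auto simp: g_def c_def d_def intro: mult_left_mono mult_left_mono_neg)
  qed
  also have "((d 1 - c 1)\<^sup>2 + (\<Sum>i=2..n. gap_alpha (spectral_lambda \<pi> (P (i - 1)))
            * ((d (i - 1) - c (i - 1))\<^sup>2 + (d i - c i)\<^sup>2)) + (d n - c n)\<^sup>2) / 16 = v * t\<^sup>2 / 2"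
    unfolding dc v_def
    by (simp add: distrib_left distrib_right add_divide_distrib sum_distrib_left sum_distrib_right sum_divide_distrib
        sum.distrib mult_ac)
  finally show ?thesis by (simp add: \<mu>_def)
qed

end

theorem mainTheorem5:
  fixes S \<pi> :: "'a measure" and M :: "'w measure"
    and P :: "nat \<Rightarrow> 'a \<Rightarrow> 'a measure" and X :: "nat \<Rightarrow> 'w \<Rightarrow> 'a"
    and l :: "nat \<Rightarrow> real" and n :: nat
    and f :: "nat \<Rightarrow> 'a \<Rightarrow> real" and a b :: "nat \<Rightarrow> real"
  assumes "standard_borel_space S"
    and "prob_space \<pi>" and "sets \<pi> = sets S"
    and "markov_chain M S P X"
    and "\<And>i. i \<ge> 1 \<Longrightarrow> invariant_kernel \<pi> (P i)"
    and "distr M S (X 1) = \<pi>"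
    and "\<And>i. i \<ge> 1 \<Longrightarrow> has_absolute_spectral_gap \<pi> (P i) (1 - l i)"
    and "n \<ge> 1"
    and "\<And>i. i \<in> {1..n} \<Longrightarrow> f i \<in> borel_measurable S"
    and "\<And>i x. i \<in> {1..n} \<Longrightarrow> x \<in> space S \<Longrightarrow> f i x \<in> {a i..b i}"
  shows
    "(let v = (b 1 - a 1)\<^sup>2 / 8
            + (\<Sum>i=2..n. gap_alpha (l (i - 1)) * (((b (i - 1) - a (i - 1))\<^sup>2 + (b i - a i)\<^sup>2) / 8))
            + (b n - a n)\<^sup>2 / 8
      in sub_gaussian M (\<lambda>\<omega>. \<Sum>i=1..n. f i (X i \<omega>)) v \<and>
         v \<le> gap_alpha (Max (l ` {1..n})) * (\<Sum>i=1..n. (b i - a i)\<^sup>2 / 4))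
     \<and>
     (\<forall>\<Lambda>. \<Lambda> < 1 \<and> (\<forall>i\<ge>1. l i \<le> \<Lambda>) \<longrightarrow>
        (\<forall>t. (\<integral>\<omega>. exp (t * (\<Sum>i=1..n. (f i (X i \<omega>) - (\<integral>x. f i x \<partial>\<pi>)))) \<partial>M)
               \<le> exp (t\<^sup>2 / 2 * gap_alpha \<Lambda> * (\<Sum>i=1..n. (b i - a i)\<^sup>2 / 4)))
        \<and>
        (\<forall>\<epsilon>>0. measure M {\<omega> \<in> space M.
                   \<bar>(\<Sum>i=1..n. f i (X i \<omega>)) - (\<Sum>i=1..n. (\<integral>x. f i x \<partial>\<pi>))\<bar> > \<epsilon>}
               \<le> two_exp_neg_div (inverse (gap_alpha \<Lambda>) * \<epsilon>\<^sup>2)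
                    (2 * (\<Sum>i=1..n. (b i - a i)\<^sup>2 / 4))))"
proof -
  interpret pi: prob_space \<pi> by (rule assms)
  interpret stationary_markov_chain M S \<pi> P X
    by (rule stationary_markov_chain.intro) (use assms in auto)
  interpret M: prob_space M by (rule prob_space_M)
  have n: "1 \<le> n" by (rule assms)
  have gap: "spectral_lambda \<pi> (P i) < 1" and l: "l i = spectral_lambda \<pi> (P i)" if "i \<ge> 1" for i
    using assms(7)[OF that] by (auto simp: has_absolute_spectral_gap_def)
  have l0: "0 \<le> l i" if "i \<ge> 1" for i
    using invariant_markov_kernel.spectral_lambda_nonneg[OF invariant_markov_kernel[OF that]] l[OF that] by simp
  have f: "f i \<in> borel_measurable \<pi>" if "i \<in> {1..n}" for i
    using assms(9)[OF that] by (simp add: measurable_cong_sets[OF sets_pi refl])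
  have fab: "f i x \<in> {a i..b i}" if "i \<in> {1..n}" "x \<in> space \<pi>" for i x
    using assms(10) that by (simp add: space_pi)
  have fb: "f i \<in> bounded_measurable \<pi>" if "i \<in> {1..n}" for i
    using f[OF that] fab[OF that] by (rule bounded_measurable_interval)
  define \<mu> where "\<mu> i = (\<integral>x. f i x \<partial>\<pi>)" for i
  define Z where "Z \<omega> = (\<Sum>i=1..n. f i (X i \<omega>))" for \<omega>
  define W where "W \<omega> = (\<Sum>i=1..n. f i (X i \<omega>) - \<mu> i)" for \<omega>
  define v where "v = (b 1 - a 1)\<^sup>2 / 8
            + (\<Sum>i=2..n. gap_alpha (l (i - 1)) * (((b (i - 1) - a (i - 1))\<^sup>2 + (b i - a i)\<^sup>2) / 8))
            + (b n - a n)\<^sup>2 / 8"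
  define D where "D = (\<Sum>i=1..n. (b i - a i)\<^sup>2 / 4)"
  have fX: "(\<lambda>\<omega>. f i (X i \<omega>)) \<in> bounded_measurable M" if "i \<in> {1..n}" for i
    using that by (intro bounded_measurable_comp[OF fb X_measurable]) auto
  have Z: "integrable M Z"
    unfolding Z_def[abs_def] by (intro M.integrable_bounded_measurable bounded_measurable_sum fX)
  have EZ: "(\<integral>\<omega>. Z \<omega> \<partial>M) = (\<Sum>i=1..n. \<mu> i)"
    unfolding Z_def \<mu>_def
    by (subst Bochner_Integration.integral_sum)
       (auto intro!: sum.cong integral_X f M.integrable_bounded_measurable fX)
  have W: "W \<omega> = Z \<omega> - (\<Sum>i=1..n. \<mu> i)" for \<omega> by (simp add: W_def Z_def sum_subtractf)
  have Wb: "W \<in> bounded_measurable M"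
    unfolding W_def[abs_def] by (intro bounded_measurable_intros fX)
  have Wexp: "integrable M (\<lambda>\<omega>. exp (t * W \<omega>))" for t
    by (intro M.integrable_bounded_measurable bounded_measurable_exp bounded_measurable_mult
        bounded_measurable_const Wb)
  have v': "v = (b 1 - a 1)\<^sup>2 / 8
      + (\<Sum>i=2..n. gap_alpha (spectral_lambda \<pi> (P (i - 1)))
            * (((b (i - 1) - a (i - 1))\<^sup>2 + (b i - a i)\<^sup>2) / 8)) + (b n - a n)\<^sup>2 / 8"
    unfolding v_def using l by (auto intro!: sum.cong)
  have mgf: "(\<integral>\<omega>. exp (t * W \<omega>) \<partial>M) \<le> exp (v * t\<^sup>2 / 2)" for t
    unfolding W_def \<mu>_def v' by (intro expectation_exp_sum_le gap f fab n)
  have v_le: "v \<le> gap_alpha L * D" if "L < 1" "\<And>i. i \<in> {1..n} \<Longrightarrow> l i \<le> L" for L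
    unfolding v_def D_def using n that l0
    by (intro variance_proxy_le[where c = "\<lambda>i. (b i - a i)\<^sup>2"]) auto
  have "sub_gaussian M Z v"
    unfolding sub_gaussian_def EZ W[symmetric] using Z Wexp mgf by auto
  moreover have "v \<le> gap_alpha (Max (l ` {1..n})) * D"
  \<comment> \<open>The maximum reaches up to \<open>l n\<close>, the kernel leaving the last
    summand. It is below 1 because every kernel of index at least 1 has a gap and the index set is
    finite and nonempty.\<close>
  proof (rule v_le)
    show "Max (l ` {1..n}) < 1" using n gap l by (subst Max_less_iff) auto
  qed auto
  moreover have mgf': "(\<integral>\<omega>. exp (t * W \<omega>) \<partial>M) \<le> exp (gap_alpha L * D * t\<^sup>2 / 2)"
    if "L < 1" "\<And>i. i \<ge> 1 \<Longrightarrow> l i \<le> L" for L t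
  proof -
    have "v * t\<^sup>2 / 2 \<le> gap_alpha L * D * t\<^sup>2 / 2"
      using v_le[of L] that by (intro divide_right_mono mult_right_mono) auto
    then show ?thesis using mgf[of t] by (meson exp_le_cancel_iff order_trans)
  qed
  moreover have "measure M {\<omega> \<in> space M. \<bar>Z \<omega> - (\<Sum>i=1..n. \<mu> i)\<bar> > \<epsilon>}
      \<le> two_exp_neg_div (inverse (gap_alpha L) * \<epsilon>\<^sup>2) (2 * D)"
    if L: "L < 1" "\<And>i. i \<ge> 1 \<Longrightarrow> l i \<le> L" and \<epsilon>: "0 < \<epsilon>" for L \<epsilon>
  proof (cases "D = 0")
    \<comment> \<open>The bound is 0 here by the convention in \<open>two_exp_neg_div\<close>, so
      the event has to be empty: each \<open>f i\<close> is constant and the sum equals its mean at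
      every point.\<close>
    case True
    then have ab: "a i = b i" if "i \<in> {1..n}" for i
      using that unfolding D_def by (subst (asm) sum_nonneg_eq_0_iff) auto
    have fa: "f i x = a i" if "i \<in> {1..n}" "x \<in> space \<pi>" for i x
      using fab[OF that] ab[OF that(1)] by simp
    have \<mu>: "\<mu> i = a i" if "i \<in> {1..n}" for i
    proof -
      have "\<mu> i = (\<integral>x. a i \<partial>\<pi>)"
        unfolding \<mu>_def using fa[OF that] by (intro Bochner_Integration.integral_cong) auto
      then show ?thesis by (simp add: pi.prob_space)
    qed
    have "Z \<omega> = (\<Sum>i=1..n. \<mu> i)" if "\<omega> \<in> space M" for \<omega>
      unfolding Z_def using that measurable_space[OF X_measurable] by (intro sum.cong) (auto simp: \<mu> fa)
    then have "{\<omega> \<in> space M. \<bar>Z \<omega> - (\<Sum>i=1..n. \<mu> i)\<bar> > \<epsilon>} = {}" using \<epsilon> by auto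
    then show ?thesis using True by (simp only: measure_empty) (simp add: two_exp_neg_div_def)
  next
    case False
    moreover have "0 \<le> D" unfolding D_def by (intro sum_nonneg) auto
    ultimately have D: "0 < D" by simp
    \<comment> \<open>\<open>L\<close> is nonnegative because it dominates \<open>l 1\<close>, which
      is a supremum of a set containing 0.\<close>
    have \<alpha>: "1 \<le> gap_alpha L" using L l0[of 1] by (intro gap_alpha_ge_1) force+
    have "measure M {\<omega> \<in> space M. \<epsilon> < \<bar>W \<omega>\<bar>} \<le> 2 * exp (- (\<epsilon>\<^sup>2 / (2 * (gap_alpha L * D))))"
      using D \<alpha> by (intro M.sub_gaussian_two_sided_tail Wexp mgf' L \<epsilon> bounded_measurableD[OF Wb]) auto
    also have "\<dots> = two_exp_neg_div (inverse (gap_alpha L) * \<epsilon>\<^sup>2) (2 * D)"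
      using D \<alpha> by (simp add: two_exp_neg_div_def field_simps)
    finally show ?thesis by (simp add: W)
  qed
  ultimately show ?thesis
    unfolding Let_def v_def[symmetric] Z_def[symmetric, abs_def] Z_def[symmetric] \<mu>_def[symmetric] W_def[symmetric] D_def[symmetric]
    by (auto simp: mult_ac)
qed

end
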